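(* Let $\mathbb{G}$ be a reduced graph of order $n$ and rank $r\geqslant 10$ with $n>m(r)$, and suppose $\mathbb{G}$ has the minimum possible order among all reduced graphs $G'$ of some rank $r'\geqslant 2$ with $|G'|>m(r')$. Let $\tau=\tau(\mathbb{G})$ and let $H$ be an induced subgraph of $\mathbb{G}$ of order $n-\tau$ which has duplicated vertices, and suppose $\mathrm{rank}(H)\geqslant r-3$. Let $\epsilon$ be the number of isolated vertices of $H$, and let $S$ be the induced subgraph of $\mathbb{G}$ on a set consisting of exactly one vertex from each duplication class of $H$. Then $\epsilon=0$ and one of the following holds: (i) $S$ is isomorphic to $K_1$ and $\tau\geqslant m(r-2)+2$; (ii) $S$ is isomorphic to $K_2$ and $\tau\geqslant m(r-2)+1$; (iii) $S$ is isomorphic to $K_3$ and $\tau=m(r-2)$.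
   Context: All graphs are finite and simple; $K_k$ is the complete graph on $k$ vertices. The rank of a graph is the rank over $\mathbb{R}$ of its adjacency matrix. A graph is reduced if it has no isolated vertices and no two distinct vertices with the same set of neighbors; two distinct vertices with the same neighborhood (in the graph under consideration) are duplicated vertices. A duplication class of a graph is a maximal set of at least two vertices all having the same neighborhood in that graph. For a non-complete graph $G$, $\tau(G)$ is the minimum number of vertices whose removal results in a graph having duplicated vertices. For integers $r$, $m(r)=2^{(r+2)/2}-2$ if $r$ is even and $m(r)=5\cdot 2^{(r-3)/2}-2$ if $r$ is odd. (The isomorphism type of $S$ does not depend on the choice of representatives.) *)

theory Defs
  imports
    "Graph_Theory.Graph_Theory"
    "Jordan_Normal_Form.DL_Rank"
begin

text \<open>Finite simple graphs are the digraphs satisfying the locale predicate \<^const>\<open>graph\<close>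
  (finite, loop-free, no parallel arcs, symmetric); an edge is a pair of opposite arcs.\<close>

definition neighborhood :: "('a, 'b) pre_digraph \<Rightarrow> 'a \<Rightarrow> 'a set" where
  "neighborhood G v = {u \<in> verts G. v \<rightarrow>\<^bsub>G\<^esub> u}"

definition isolated_verts :: "('a, 'b) pre_digraph \<Rightarrow> 'a set" where
  "isolated_verts G = {v \<in> verts G. neighborhood G v = {}}"

definition has_duplicated_verts :: "('a, 'b) pre_digraph \<Rightarrow> bool" where
  "has_duplicated_verts G \<longleftrightarrow>
     (\<exists>u \<in> verts G. \<exists>v \<in> verts G. u \<noteq> v \<and> neighborhood G u = neighborhood G v)"

definition reduced :: "('a, 'b) pre_digraph \<Rightarrow> bool" where
  "reduced G \<longleftrightarrow> isolated_verts G = {} \<and> \<not> has_duplicated_verts G"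

definition duplication_set :: "('a, 'b) pre_digraph \<Rightarrow> 'a set \<Rightarrow> bool" where
  "duplication_set G C \<longleftrightarrow>
     C \<subseteq> verts G \<and> 2 \<le> card C \<and> (\<forall>u \<in> C. \<forall>v \<in> C. neighborhood G u = neighborhood G v)"

definition duplication_class :: "('a, 'b) pre_digraph \<Rightarrow> 'a set \<Rightarrow> bool" where
  "duplication_class G C \<longleftrightarrow>
     duplication_set G C \<and> (\<forall>D. duplication_set G D \<and> C \<subseteq> D \<longrightarrow> D = C)"

definition adjacency_matrix :: "('a, 'b) pre_digraph \<Rightarrow> 'a list \<Rightarrow> real mat" where
  "adjacency_matrix G vs =
     mat (length vs) (length vs) (\<lambda>(i, j). if vs ! i \<rightarrow>\<^bsub>G\<^esub> vs ! j then 1 else 0)"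

text \<open>The rank does not depend on the order in which the vertices are listed.\<close>

definition graph_rank :: "('a, 'b) pre_digraph \<Rightarrow> nat" where
  "graph_rank G = vec_space.rank (card (verts G))
     (adjacency_matrix G (SOME vs. distinct vs \<and> set vs = verts G))"

text \<open>Only meaningful for non-complete finite graphs: for a complete graph no removal yields
  duplicated vertices and the value is unspecified.\<close>

definition tau :: "('a, 'b) pre_digraph \<Rightarrow> nat" where
  "tau G = (LEAST k. \<exists>X \<subseteq> verts G. card X = k \<and> has_duplicated_verts (G \<restriction> (verts G - X)))"

text \<open>Real-valued, since the odd formula is fractional for \<open>r < 3\<close>; the divisions are exact.\<close>

definition m_bound :: "int \<Rightarrow> real" where
  "m_bound r = (if even r then 2 powi ((r + 2) div 2) - 2 else 5 * 2 powi ((r - 3) div 2) - 2)"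

end

theory Submission
  imports Defs
begin

text \<open>
  Let \<open>X\<close> be the set of the \<open>\<tau>\<close> removed vertices. By the minimality of \<open>\<tau>\<close>, the duplication classes of
  \<open>H\<close> are pairs \<open>{t, t'}\<close>, and every vertex of \<open>X\<close> is adjacent to exactly one of \<open>t\<close> and \<open>t'\<close>. Each such
  pair gives a vector of the kernel of the adjacency matrix of \<open>H\<close>, whose image on \<open>X\<close> is a \<open>\<plusminus>1\<close> vector;
  since the rank of \<open>H\<close> is at least \<open>r - 3\<close>, all these images are parallel. Hence there is a partition
  of \<open>X\<close> into \<open>P\<close> and \<open>Q\<close> such that every duplicated vertex has \<open>P\<close> or \<open>Q\<close> as its neighbourhood in
  \<open>X\<close>, and an isolated vertex of \<open>H\<close> is unique and adjacent to all of \<open>X\<close>.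

  Let \<open>T\<close> be a set of representatives of the pairs and \<open>D\<close> the set of the vertices of \<open>H\<close> that are
  neither duplicated nor isolated. The graph on \<open>D \<union> T\<close> is reduced and of rank at most \<open>r - 2\<close>, so
  minimality of the counterexample bounds its order by \<open>m(r - 2)\<close>. As \<open>m(r) + 2\<close> doubles when \<open>r\<close>
  grows by two, this gives \<open>\<tau> + |T| + \<epsilon> \<ge> m(r - 2) + 3\<close> and \<open>|D| < \<tau>\<close>. By the latter, duplicated
  vertices of \<open>T\<close>, or of \<open>P\<close>, or of \<open>Q\<close>, would contradict the minimality of \<open>\<tau>\<close>. Let \<open>M\<close> be the
  adjacency matrix of \<open>X\<close> bordered by the \<open>\<plusminus>1\<close> vector above. Because every row of \<open>T\<close> is, up to a
  multiple of that vector, constant on \<open>X\<close>, the ranks of \<open>T\<close> and \<open>M\<close> add up to at most \<open>r + 1\<close>, while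
  minimality of the counterexample bounds \<open>|T|\<close> and \<open>|X| = \<tau>\<close> in terms of these ranks. Since \<open>m\<close> grows
  exponentially, these bounds contradict the lower bound on \<open>\<tau> + |T|\<close> unless \<open>T\<close> is a clique on at
  most three vertices. If \<open>H\<close> has an isolated vertex \<open>w\<close>, then the representatives without neighbours
  in \<open>X\<close> and the reduced graph on \<open>X \<union> {w}\<close> are not joined by edges, and a similar count of ranks
  excludes this case.
\<close>

section \<open>Dual systems and the rank\<close>

definition adj_form :: "('a \<Rightarrow> 'a \<Rightarrow> bool) \<Rightarrow> 'a set \<Rightarrow> ('a \<Rightarrow> real) \<Rightarrow> ('a \<Rightarrow> real) \<Rightarrow> real" where
  "adj_form E V f g = (\<Sum>u\<in>V. \<Sum>v\<in>V. f u * of_bool (E u v) * g v)"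

definition supported :: "'a set \<Rightarrow> ('a \<Rightarrow> real) set" where
  "supported S = {f. \<forall>x. x \<notin> S \<longrightarrow> f x = 0}"

definition unit_fun :: "'a \<Rightarrow> 'a \<Rightarrow> real" where
  "unit_fun v = (\<lambda>x. of_bool (x = v))"

text \<open>The rank of the form is at least \<open>k\<close> on \<open>U \<times> W\<close>, witnessed by a pair of dual systems of
  vectors. Such systems are easier to extend and transform than sets of independent rows.\<close>

definition dual_systems ::
    "(('a \<Rightarrow> real) \<Rightarrow> ('a \<Rightarrow> real) \<Rightarrow> real) \<Rightarrow> ('a \<Rightarrow> real) set \<Rightarrow> ('a \<Rightarrow> real) set \<Rightarrow> nat \<Rightarrow> bool" where
  "dual_systems B U W k \<longleftrightarrow> (\<exists>p q. (\<forall>i<k. p i \<in> U \<and> q i \<in> W) \<and>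
     (\<forall>i<k. \<forall>j<k. B (p i) (q j) = of_bool (i = j)))"

definition lin_closed :: "('a \<Rightarrow> real) set \<Rightarrow> bool" where
  "lin_closed U \<longleftrightarrow> (\<lambda>x. 0) \<in> U \<and> (\<forall>f\<in>U. \<forall>g\<in>U. \<forall>c. (\<lambda>x. f x + c * g x) \<in> U)"

lemma lin_closedD: "lin_closed U \<Longrightarrow> f \<in> U \<Longrightarrow> g \<in> U \<Longrightarrow> (\<lambda>x. f x + c * g x) \<in> U"
  by (auto simp: lin_closed_def)

lemma lin_closed_zero: "lin_closed U \<Longrightarrow> (\<lambda>x. 0) \<in> U"
  by (auto simp: lin_closed_def)

lemma lin_closed_scale: "lin_closed U \<Longrightarrow> f \<in> U \<Longrightarrow> (\<lambda>x. c * f x) \<in> U"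
  using lin_closedD[of U "\<lambda>x. 0" f c] lin_closed_zero[of U] by simp

lemma lin_closed_sum:
  assumes "lin_closed U" and "\<And>i. i \<in> I \<Longrightarrow> f i \<in> U"
  shows "(\<lambda>x. \<Sum>i\<in>I. c i * f i x) \<in> U"
  using assms(2)
proof (induction I rule: infinite_finite_induct)
  case (insert i I)
  have "(\<lambda>x. (\<Sum>i\<in>I. c i * f i x) + c i * f i x) \<in> U"
    using insert by (intro lin_closedD[OF assms(1)]) auto
  then show ?case using insert.hyps by (simp add: add.commute)
qed (use lin_closed_zero[OF assms(1)] in auto)

lemma lin_closed_supported: "lin_closed (supported S)"
  by (auto simp: lin_closed_def supported_def)

lemma supported_mono: "S \<subseteq> S' \<Longrightarrow> supported S \<subseteq> supported S'"
  by (auto simp: supported_def)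

lemma unit_fun_supported: "v \<in> S \<Longrightarrow> unit_fun v \<in> supported S"
  by (auto simp: supported_def unit_fun_def)

lemma adj_form_left: "adj_form E V (\<lambda>x. f x + c * g x) h = adj_form E V f h + c * adj_form E V g h"
  by (simp add: adj_form_def algebra_simps sum.distrib sum_distrib_left)

lemma adj_form_right: "adj_form E V h (\<lambda>x. f x + c * g x) = adj_form E V h f + c * adj_form E V h g"
  by (simp add: adj_form_def algebra_simps sum.distrib sum_distrib_left)

lemma adj_form_zero: "adj_form E V (\<lambda>x. 0) h = 0" "adj_form E V h (\<lambda>x. 0) = 0"
  by (simp_all add: adj_form_def)

lemma adj_form_scale:
  "adj_form E V (\<lambda>x. c * g x) h = c * adj_form E V g h"
  "adj_form E V h (\<lambda>x. c * g x) = c * adj_form E V h g"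
  using adj_form_left[of E V "\<lambda>x. 0" c g h] adj_form_right[of E V h "\<lambda>x. 0" c g]
  by (simp_all add: adj_form_zero)

lemma adj_form_minus: "adj_form E V (\<lambda>x. f x - g x) h = adj_form E V f h - adj_form E V g h"
  using adj_form_left[of E V f "-1" g h] by simp

lemma adj_form_divide: "adj_form E V (\<lambda>x. f x / c) h = adj_form E V f h / c"
  using adj_form_scale(1)[of E V "1 / c" f h] by simp

lemma adj_form_sum_left:
  "adj_form E V (\<lambda>x. \<Sum>i\<in>I. c i * f i x) h = (\<Sum>i\<in>I. c i * adj_form E V (f i) h)"
proof (induction I rule: infinite_finite_induct)
  case (insert i I)
  then show ?case
    using adj_form_left[of E V "\<lambda>x. \<Sum>i\<in>I. c i * f i x" "c i" "f i" h] by (simp add: add.commute)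
qed (simp_all add: adj_form_zero)

lemma adj_form_sum_right:
  "adj_form E V h (\<lambda>x. \<Sum>i\<in>I. c i * f i x) = (\<Sum>i\<in>I. c i * adj_form E V h (f i))"
proof (induction I rule: infinite_finite_induct)
  case (insert i I)
  then show ?case
    using adj_form_right[of E V h "\<lambda>x. \<Sum>i\<in>I. c i * f i x" "c i" "f i"] by (simp add: add.commute)
qed (simp_all add: adj_form_zero)

lemma adj_form_swap: "symp_on V E \<Longrightarrow> adj_form E V f g = adj_form E V g f"
  unfolding adj_form_def
  by (subst sum.swap, intro sum.cong refl) (auto dest: symp_onD)

lemma adj_form_unit_right:
  assumes "finite V" "v \<in> V"
  shows "adj_form E V f (unit_fun v) = (\<Sum>u\<in>V. f u * of_bool (E u v))"
proof -
  have "adj_form E V f (unit_fun v) = (\<Sum>u\<in>V. \<Sum>v'\<in>V. if v' = v then f u * of_bool (E u v) else 0)"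
    unfolding adj_form_def unit_fun_def by (intro sum.cong refl) auto
  then show ?thesis using assms by simp
qed

lemma adj_form_unit_left:
  assumes "finite V" "u \<in> V"
  shows "adj_form E V (unit_fun u) g = (\<Sum>v\<in>V. of_bool (E u v) * g v)"
proof -
  have "adj_form E V (unit_fun u) g = (\<Sum>u'\<in>V. if u' = u then (\<Sum>v\<in>V. of_bool (E u v) * g v) else 0)"
    unfolding adj_form_def unit_fun_def by (intro sum.cong refl) auto
  then show ?thesis using assms by simp
qed

lemma adj_form_units:
  assumes "finite V" "u \<in> V" "v \<in> V"
  shows "adj_form E V (unit_fun u) (unit_fun v) = of_bool (E u v)"
  using assms by (simp add: adj_form_unit_left) (simp add: unit_fun_def of_bool_def sum.delta if_distrib cong: if_cong)

lemma supported_expand: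
  assumes "finite S" "f \<in> supported S"
  shows "f = (\<lambda>x. \<Sum>v\<in>S. f v * unit_fun v x)"
  using assms by (auto simp: fun_eq_iff supported_def unit_fun_def of_bool_def if_distrib sum.delta cong: if_cong)

lemma adj_form_restrict:
  assumes "finite V" "S \<subseteq> V" "f \<in> supported S" "g \<in> supported S"
  shows "adj_form E V f g = adj_form E S f g"
proof -
  have "(\<Sum>v\<in>V. f u * of_bool (E u v) * g v) = (\<Sum>v\<in>S. f u * of_bool (E u v) * g v)" for u
    using assms by (intro sum.mono_neutral_right) (auto simp: supported_def)
  moreover have "(\<Sum>u\<in>V. \<Sum>v\<in>S. f u * of_bool (E u v) * g v) = (\<Sum>u\<in>S. \<Sum>v\<in>S. f u * of_bool (E u v) * g v)"
    using assms by (intro sum.mono_neutral_right) (auto simp: supported_def)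
  ultimately show ?thesis by (simp add: adj_form_def)
qed

lemma adj_form_cong:
  "(\<And>u v. u \<in> V \<Longrightarrow> v \<in> V \<Longrightarrow> E u v = E' u v) \<Longrightarrow> adj_form E V f g = adj_form E' V f g"
  by (auto simp: adj_form_def intro!: sum.cong)

lemma dual_systemsI:
  assumes "\<And>i. i < k \<Longrightarrow> p i \<in> U" "\<And>i. i < k \<Longrightarrow> q i \<in> W"
    and "\<And>i j. i < k \<Longrightarrow> j < k \<Longrightarrow> B (p i) (q j) = of_bool (i = j)"
  shows "dual_systems B U W k"
  unfolding dual_systems_def by (rule exI[of _ p], rule exI[of _ q]) (simp add: assms)

lemma dual_systems_mono:
  assumes "dual_systems B U W k" "U \<subseteq> U'" "W \<subseteq> W'" "l \<le> k"
  shows "dual_systems B U' W' l"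
proof -
  obtain p q where pq: "\<And>i. i < k \<Longrightarrow> p i \<in> U" "\<And>i. i < k \<Longrightarrow> q i \<in> W"
    "\<And>i j. i < k \<Longrightarrow> j < k \<Longrightarrow> B (p i) (q j) = of_bool (i = j)"
    using assms(1) unfolding dual_systems_def by blast
  show ?thesis by (rule dual_systemsI[of _ p _ q]) (use pq assms in auto)
qed

lemma dual_systems_cong:
  assumes "dual_systems B U W k" and "\<And>f g. f \<in> U \<Longrightarrow> g \<in> W \<Longrightarrow> B f g = B' f g"
  shows "dual_systems B' U W k"
proof -
  obtain p q where pq: "\<And>i. i < k \<Longrightarrow> p i \<in> U" "\<And>i. i < k \<Longrightarrow> q i \<in> W"
    "\<And>i j. i < k \<Longrightarrow> j < k \<Longrightarrow> B (p i) (q j) = of_bool (i = j)"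
    using assms(1) unfolding dual_systems_def by blast
  show ?thesis by (rule dual_systemsI[of _ p _ q]) (use pq assms in auto)
qed

lemma dual_systems_transpose:
  assumes "dual_systems B U W k"
  shows "dual_systems (\<lambda>f g. B g f) W U k"
proof -
  obtain p q where pq: "\<And>i. i < k \<Longrightarrow> p i \<in> U" "\<And>i. i < k \<Longrightarrow> q i \<in> W"
    "\<And>i j. i < k \<Longrightarrow> j < k \<Longrightarrow> B (p i) (q j) = of_bool (i = j)"
    using assms(1) unfolding dual_systems_def by blast
  show ?thesis by (rule dual_systemsI[of _ q _ p]) (use pq in auto)
qed

text \<open>Correcting the second system by the first one diagonalizes the block triangular Gram matrix.\<close>

lemma dual_systems_block:
  assumes 1: "dual_systems (adj_form E V) U\<^sub>1 W\<^sub>1 k" and 2: "dual_systems (adj_form E V) U\<^sub>2 W\<^sub>2 l"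
    and zero: "\<And>f g. f \<in> U\<^sub>1 \<Longrightarrow> g \<in> W\<^sub>2 \<Longrightarrow> adj_form E V f g = 0"
    and sub: "U\<^sub>1 \<subseteq> U" "U\<^sub>2 \<subseteq> U" "W\<^sub>1 \<subseteq> W" "W\<^sub>2 \<subseteq> W" "lin_closed U"
  shows "dual_systems (adj_form E V) U W (k + l)"
proof -
  let ?B = "adj_form E V"
  obtain p q where pq: "\<And>i. i < k \<Longrightarrow> p i \<in> U\<^sub>1" "\<And>i. i < k \<Longrightarrow> q i \<in> W\<^sub>1"
    "\<And>i j. i < k \<Longrightarrow> j < k \<Longrightarrow> ?B (p i) (q j) = of_bool (i = j)"
    using 1 unfolding dual_systems_def by blast
  obtain p' q' where pq': "\<And>i. i < l \<Longrightarrow> p' i \<in> U\<^sub>2" "\<And>i. i < l \<Longrightarrow> q' i \<in> W\<^sub>2"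
    "\<And>i j. i < l \<Longrightarrow> j < l \<Longrightarrow> ?B (p' i) (q' j) = of_bool (i = j)"
    using 2 unfolding dual_systems_def by blast
  define s where "s i = (\<lambda>x. \<Sum>m<k. ?B (p' i) (q m) * p m x)" for i
  define P where "P i = (if i < k then p i else (\<lambda>x. p' (i - k) x + (- 1) * s (i - k) x))" for i
  define Q where "Q i = (if i < k then q i else q' (i - k))" for i
  have sU: "s i \<in> U" for i
    unfolding s_def using pq(1) sub by (intro lin_closed_sum) auto
  have s1: "?B (s i) (q j) = ?B (p' i) (q j)" if "j < k" for i j
  proof -
    have "?B (s i) (q j) = (\<Sum>m<k. ?B (p' i) (q m) * of_bool (m = j))"
      unfolding s_def adj_form_sum_left using pq(3) that by (intro sum.cong) auto
    also have "\<dots> = ?B (p' i) (q j)" using that by (simp add: of_bool_def if_distrib sum.delta cong: if_cong)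
    finally show ?thesis .
  qed
  have s2: "?B (s i) (q' j) = 0" if "j < l" for i j
    unfolding s_def adj_form_sum_left using zero pq(1) pq'(2) that by auto
  show ?thesis
  proof (rule dual_systemsI[of _ P _ Q])
    fix i assume "i < k + l"
    then have "p' (i - k) \<in> U" if "\<not> i < k" using that pq'(1)[of "i - k"] sub by auto
    then show "P i \<in> U"
      using pq(1) sub lin_closedD[OF sub(5) _ sU, of "p' (i - k)" "- 1" "i - k"]
      by (auto simp: P_def)
    show "Q i \<in> W" using \<open>i < k + l\<close> pq(2) pq'(2)[of "i - k"] sub by (auto simp: Q_def)
  next
    fix i j assume ij: "i < k + l" "j < k + l"
    consider "i < k" "j < k" | "i < k" "\<not> j < k" | "\<not> i < k" "j < k" | "\<not> i < k" "\<not> j < k" by blast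
    then show "?B (P i) (Q j) = of_bool (i = j)"
    proof cases
      case 1 then show ?thesis by (simp add: P_def Q_def pq)
    next
      case 2
      then show ?thesis using ij zero[OF pq(1) pq'(2), of i "j - k"] by (auto simp: P_def Q_def)
    next
      case 3
      then show ?thesis using ij s1 by (auto simp: P_def Q_def adj_form_minus)
    next
      case 4
      then have "i - k < l" "j - k < l" "(i - k = j - k) = (i = j)" using ij by auto
      then show ?thesis using 4 pq'(3) s2 by (simp add: P_def Q_def adj_form_minus)
    qed
  qed
qed

text \<open>The multiples of \<open>z\<close> against \<open>g\<close> form a block of size one; as
  \<open>z\<close> vanishes on \<open>W\<close>, the joint Gram matrix is block triangular.\<close>

lemma dual_systems_border:
  assumes d: "dual_systems (adj_form E V) U W k"
    and z: "\<And>w. w \<in> W \<Longrightarrow> adj_form E V z w = 0" and g: "adj_form E V z g \<noteq> 0"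
    and sub: "U \<subseteq> U'" "W \<subseteq> W'" "z \<in> U'" "g \<in> W'" "lin_closed U'"
  shows "dual_systems (adj_form E V) U' W' (Suc k)"
proof -
  have "dual_systems (adj_form E V) (range (\<lambda>c x. c * z x)) {g} 1"
    by (rule dual_systemsI[of _ "\<lambda>_ x. (1 / adj_form E V z g) * z x" _ "\<lambda>_. g"])
      (use g in \<open>auto simp: adj_form_scale simp del: times_divide_eq_left, auto\<close>)
  moreover have "range (\<lambda>c x. c * z x) \<subseteq> U'"
    using lin_closed_scale[OF sub(5,3)] by auto
  moreover have "adj_form E V f w = 0" if "f \<in> range (\<lambda>c x. c * z x)" "w \<in> W" for f w
    using that z by (auto simp: adj_form_scale)
  ultimately have "dual_systems (adj_form E V) U' W' (1 + k)"
    using sub by (intro dual_systems_block[OF _ d, where W\<^sub>1 = "{g}" and U\<^sub>1 = "range (\<lambda>c x. c * z x)"]) auto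
  then show ?thesis by simp
qed

text \<open>If \<open>\<phi>\<close> is nonzero at some \<open>p m\<close>, subtracting multiples of
  \<open>p m\<close> makes it vanish at the other \<open>p i\<close>. This keeps them dual to the
  remaining \<open>q i\<close>, so only the index \<open>m\<close> is lost.\<close>

lemma dual_systems_hyperplane:
  assumes d: "dual_systems (adj_form E V) U W (Suc k)"
    and U: "lin_closed U" and \<phi>: "\<And>f g c. \<phi> (\<lambda>x. f x + c * g x) = \<phi> f + c * \<phi> g"
  shows "dual_systems (adj_form E V) {f \<in> U. \<phi> f = (0::real)} W k"
proof -
  let ?B = "adj_form E V"
  obtain p q where pq: "\<And>i. i < Suc k \<Longrightarrow> p i \<in> U" "\<And>i. i < Suc k \<Longrightarrow> q i \<in> W"
    "\<And>i j. i < Suc k \<Longrightarrow> j < Suc k \<Longrightarrow> ?B (p i) (q j) = of_bool (i = j)"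
    using d unfolding dual_systems_def by blast
  show ?thesis
  proof (cases "\<forall>i<Suc k. \<phi> (p i) = 0")
    case True
    then show ?thesis by (intro dual_systemsI[of _ p _ q]) (use pq in auto)
  next
    case False
    then obtain m where m: "m < Suc k" "\<phi> (p m) \<noteq> 0" by blast
    \<comment> \<open>An enumeration of the indices other than \<open>m\<close>.\<close>
    define e where "e i = (if i < m then i else Suc i)" for i :: nat
    have e: "e i < Suc k" "e i \<noteq> m" "e i = e j \<longleftrightarrow> i = j" if "i < k" "j < k" for i j
      using that m by (auto simp: e_def)
    define P where "P i = (\<lambda>x. p (e i) x + (- \<phi> (p (e i)) / \<phi> (p m)) * p m x)" for i
    have "P i \<in> U" if "i < k" for i
      unfolding P_def using e that m pq U by (intro lin_closedD) auto
    moreover have "\<phi> (P i) = 0" for i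
      unfolding P_def \<phi> using m by simp
    moreover have "?B (P i) (q (e j)) = of_bool (i = j)" if "i < k" "j < k" for i j
      unfolding P_def adj_form_left using e that m pq by (auto simp: e(2)[symmetric])
    ultimately show ?thesis
      by (intro dual_systemsI[of _ P _ "\<lambda>i. q (e i)"]) (use pq e in auto)
  qed
qed

section \<open>Dual systems and independent columns of the adjacency matrix\<close>

definition indep_cols :: "('a \<Rightarrow> 'a \<Rightarrow> bool) \<Rightarrow> 'a set \<Rightarrow> 'a set \<Rightarrow> bool" where
  "indep_cols E S J \<longleftrightarrow>
     (\<forall>c. (\<forall>u\<in>S. (\<Sum>v\<in>J. c v * of_bool (E u v)) = (0::real)) \<longrightarrow> (\<forall>v\<in>J. c v = 0))"

lemma indep_colsD:
  "indep_cols E S J \<Longrightarrow> (\<And>u. u \<in> S \<Longrightarrow> (\<Sum>v\<in>J. c v * of_bool (E u v)) = 0) \<Longrightarrow> v \<in> J \<Longrightarrow> c v = (0::real)"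
  unfolding indep_cols_def by simp

text \<open>Steinitz exchange, one index per induction step: since \<open>p m\<close> and
  \<open>q m\<close> pair to 1, some unit vector pairs nontrivially with \<open>p m\<close>. It
  takes the place of \<open>q m\<close>, and the \<open>p i\<close> are corrected to stay
  dual.\<close>

lemma dual_systems_unit_exchange:
  assumes fin: "finite S" and d: "dual_systems (adj_form E S) (supported S) (supported S) k" and "m \<le> k"
  shows "\<exists>p q. (\<forall>i<k. p i \<in> supported S \<and> q i \<in> supported S) \<and>
    (\<forall>i<k. \<forall>j<k. adj_form E S (p i) (q j) = of_bool (i = j)) \<and> (\<forall>i<m. q i \<in> unit_fun ` S)"
  using \<open>m \<le> k\<close>
proof (induction m)
  case 0
  then show ?case using d unfolding dual_systems_def by auto
next
  case (Suc m)
  let ?B = "adj_form E S"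
  obtain p q where pq: "\<And>i. i < k \<Longrightarrow> p i \<in> supported S" "\<And>i. i < k \<Longrightarrow> q i \<in> supported S"
    "\<And>i j. i < k \<Longrightarrow> j < k \<Longrightarrow> ?B (p i) (q j) = of_bool (i = j)" "\<And>i. i < m \<Longrightarrow> q i \<in> unit_fun ` S"
    using Suc.IH[OF Suc_leD[OF Suc.prems]] by blast
  have m: "m < k" using Suc.prems by simp
  have "?B (p m) (q m) = (\<Sum>v\<in>S. q m v * ?B (p m) (unit_fun v))"
    by (subst supported_expand[OF fin pq(2)[OF m]]) (simp add: adj_form_sum_right)
  then have "(\<Sum>v\<in>S. q m v * ?B (p m) (unit_fun v)) \<noteq> 0" using pq(3)[OF m m] by simp
  then obtain v where v: "v \<in> S" "?B (p m) (unit_fun v) \<noteq> 0"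
    by (metis (mono_tags, lifting) mult_zero_right sum.neutral)
  define b where "b i = ?B (p i) (unit_fun v)" for i
  define P where "P i = (if i = m then (\<lambda>x. (1 / b m) * p m x) else (\<lambda>x. p i x + (- b i / b m) * p m x))" for i
  define Q where "Q = q(m := unit_fun v)"
  have b: "b m \<noteq> 0" using v by (simp add: b_def)
  have "P i \<in> supported S" if "i < k" for i
    unfolding P_def using pq(1)[OF that] pq(1)[OF m]
    by (auto simp: supported_def)
  moreover have "Q i \<in> supported S" if "i < k" for i
    unfolding Q_def using pq(2)[OF that] unit_fun_supported[OF v(1)] by auto
  moreover have "?B (P i) (Q j) = of_bool (i = j)" if "i < k" "j < k" for i j
    using that b pq(3) m
    by (auto simp: P_def Q_def adj_form_minus adj_form_divide adj_form_scale b_def[symmetric])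
  moreover have "Q i \<in> unit_fun ` S" if "i < Suc m" for i
    using that pq(4) v by (auto simp: Q_def less_Suc_eq)
  ultimately show ?case by blast
qed

text \<open>Once the second system consists of unit vectors, these name the columns; pairing a
  vanishing combination of the columns with \<open>p i\<close> isolates its coefficient at the
  \<open>i\<close>-th of them.\<close>

lemma dual_systems_imp_indep_cols:
  assumes fin: "finite S" and d: "dual_systems (adj_form E S) (supported S) (supported S) k"
  obtains J where "J \<subseteq> S" "card J = k" "indep_cols E S J"
proof -
  let ?B = "adj_form E S"
  obtain p q where pq: "\<And>i. i < k \<Longrightarrow> p i \<in> supported S"
    "\<And>i j. i < k \<Longrightarrow> j < k \<Longrightarrow> ?B (p i) (q j) = of_bool (i = j)" "\<And>i. i < k \<Longrightarrow> q i \<in> unit_fun ` S"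
    using dual_systems_unit_exchange[OF fin d order_refl] by blast
  define w where "w i = inv_into S unit_fun (q i)" for i
  have w: "w i \<in> S" "q i = unit_fun (w i)" if "i < k" for i
    using pq(3)[OF that] by (simp_all add: w_def inv_into_into f_inv_into_f)
  have B: "?B (p i) (unit_fun (w j)) = of_bool (i = j)" if "i < k" "j < k" for i j
    using pq(2)[OF that] w(2)[OF that(2)] by simp
  have inj: "inj_on w {..<k}"
  proof (rule inj_onI)
    fix i j assume ij: "i \<in> {..<k}" "j \<in> {..<k}" "w i = w j"
    then have "?B (p i) (unit_fun (w i)) = ?B (p i) (unit_fun (w j))" by simp
    then show "i = j" using B[of i i] B[of i j] ij by (auto split: if_splits)
  qed
  have "indep_cols E S (w ` {..<k})" unfolding indep_cols_def
  proof (intro allI impI ballI)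
    fix c v assume c: "\<forall>u\<in>S. (\<Sum>v\<in>w ` {..<k}. c v * of_bool (E u v)) = (0::real)" and v: "v \<in> w ` {..<k}"
    then obtain i where i: "i < k" "v = w i" by auto
    have "(\<Sum>j<k. c (w j) * ?B (p i) (unit_fun (w j))) = (\<Sum>j<k. if j = i then c (w i) else 0)"
      using B i by (intro sum.cong) auto
    also have "\<dots> = c v" using i by simp
    finally have 1: "(\<Sum>j<k. c (w j) * ?B (p i) (unit_fun (w j))) = c v" .
    have "(\<Sum>j<k. c (w j) * ?B (p i) (unit_fun (w j))) = (\<Sum>v\<in>w ` {..<k}. c v * ?B (p i) (unit_fun v))"
      by (simp add: sum.reindex[OF inj])
    also have "\<dots> = (\<Sum>v\<in>w ` {..<k}. c v * (\<Sum>u\<in>S. p i u * of_bool (E u v)))"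
      using w fin by (intro sum.cong refl) (auto simp: adj_form_unit_right)
    also have "\<dots> = (\<Sum>u\<in>S. p i u * (\<Sum>v\<in>w ` {..<k}. c v * of_bool (E u v)))"
      unfolding sum_distrib_left by (subst sum.swap) (simp only: mult.left_commute)
    also have "\<dots> = 0" using c by simp
    finally show "c v = 0" using 1 by simp
  qed
  then show thesis using that[of "w ` {..<k}"] w inj by (auto simp: card_image)
qed

text \<open>Induction on \<open>J\<close>: by independence, the new column \<open>x\<close> differs
  in some row \<open>u\<close> from the combination of old columns with coefficients
  \<open>c\<close>. This row yields a functional that vanishes on \<open>J\<close> but not at
  \<open>x\<close>.\<close>

lemma indep_cols_dual_functionals:
  assumes fin: "finite S" "finite J" and J: "J \<subseteq> S" "indep_cols E S J"
  shows "\<exists>p. \<forall>v\<in>J. p v \<in> supported S \<and> (\<forall>w\<in>J. adj_form E S (p v) (unit_fun w) = of_bool (v = w))"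
  using fin(2) J
proof (induction J)
  case empty
  then show ?case by auto
next
  case (insert x J)
  let ?B = "adj_form E S"
  have "indep_cols E S J" unfolding indep_cols_def
  proof (intro allI impI)
    fix c assume c: "\<forall>u\<in>S. (\<Sum>v\<in>J. c v * of_bool (E u v)) = (0::real)"
    have "(\<Sum>v\<in>insert x J. (if v = x then 0 else c v) * of_bool (E u v)) = (\<Sum>v\<in>J. c v * of_bool (E u v))" for u
      unfolding sum.insert[OF insert.hyps(1,2)] using insert.hyps by (simp, intro sum.cong) auto
    then have 0: "(\<Sum>v\<in>insert x J. (if v = x then 0 else c v) * of_bool (E u v)) = 0" if "u \<in> S" for u
      using c that by (metis (no_types))
    show "\<forall>v\<in>J. c v = 0"
    proof
      fix v assume "v \<in> J"
      then show "c v = 0"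
        using indep_colsD[OF insert.prems(2), of "\<lambda>v. if v = x then 0 else c v" v, OF 0] insert.hyps
        by (auto split: if_splits)
    qed
  qed
  then obtain p where p: "\<And>v. v \<in> J \<Longrightarrow> p v \<in> supported S"
    "\<And>v w. v \<in> J \<Longrightarrow> w \<in> J \<Longrightarrow> ?B (p v) (unit_fun w) = of_bool (v = w)"
    using insert by auto
  define c where "c v = ?B (p v) (unit_fun x)" for v
  have "\<exists>u\<in>S. of_bool (E u x) - (\<Sum>v\<in>J. c v * of_bool (E u v)) \<noteq> 0"
  proof (rule ccontr)
    assume "\<not> ?thesis"
    then have a: "of_bool (E u x) - (\<Sum>v\<in>J. c v * of_bool (E u v)) = 0" if "u \<in> S" for u using that by blast
    have b: "(\<Sum>v\<in>J. (if v = x then 1 else - c v) * of_bool (E u v)) = - (\<Sum>v\<in>J. c v * of_bool (E u v))" for u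
      unfolding sum_negf[symmetric] using insert.hyps by (intro sum.cong) auto
    have "(\<Sum>v\<in>insert x J. (if v = x then 1 else - c v) * of_bool (E u v)) = 0" if "u \<in> S" for u
      using a[OF that] by (simp only: sum.insert[OF insert.hyps(1,2)] b refl if_True mult_1_left)
    from indep_colsD[OF insert.prems(2) this, of x] show False by simp
  qed
  then obtain u where u: "u \<in> S" "of_bool (E u x) - (\<Sum>v\<in>J. c v * of_bool (E u v)) \<noteq> 0" by blast
  \<comment> \<open>Row \<open>u\<close>, with its values on \<open>J\<close> cancelled by the dual
    functionals found so far.\<close>
  define z where "z = (\<lambda>y. unit_fun u y + (- 1) * (\<Sum>v\<in>J. of_bool (E u v) * p v y))"
  have xS: "x \<in> S" and JS: "J \<subseteq> S" using insert.prems by auto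
  have zS: "z \<in> supported S"
    unfolding z_def by (intro lin_closedD[OF lin_closed_supported] unit_fun_supported u lin_closed_sum p lin_closed_supported)
  have zw: "?B z (unit_fun w) = 0" if "w \<in> J" for w
  proof -
    have "(\<Sum>v\<in>J. of_bool (E u v) * ?B (p v) (unit_fun w)) = (\<Sum>v\<in>J. if v = w then of_bool (E u w) else 0)"
      using p that by (intro sum.cong) auto
    then show ?thesis
      using that JS u insert.hyps fin unfolding z_def adj_form_left adj_form_sum_left
      by (auto simp: adj_form_units)
  qed
  define e where "e = ?B z (unit_fun x)"
  have e: "e \<noteq> 0"
    using u xS fin unfolding e_def z_def adj_form_left adj_form_sum_left
    by (simp add: adj_form_units c_def mult.commute)
  define P where "P v = (if v = x then (\<lambda>y. (1 / e) * z y) else (\<lambda>y. p v y + (- c v / e) * z y))" for v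
  have "P v \<in> supported S" if "v \<in> insert x J" for v
    using that p(1)[of v] zS by (auto simp: P_def supported_def)
  moreover have "?B (P v) (unit_fun w) = of_bool (v = w)" if "v \<in> insert x J" "w \<in> insert x J" for v w
    using that e p(2) zw insert.hyps
    by (auto simp: P_def adj_form_minus adj_form_divide adj_form_scale e_def[symmetric] c_def[symmetric])
  ultimately show ?case by blast
qed

lemma indep_cols_imp_dual_systems:
  assumes "finite S" "J \<subseteq> S" "indep_cols E S J"
  shows "dual_systems (adj_form E S) (supported S) (supported S) (card J)"
proof -
  have fJ: "finite J" using assms finite_subset by blast
  obtain p where p: "\<And>v. v \<in> J \<Longrightarrow> p v \<in> supported S"
    "\<And>v w. v \<in> J \<Longrightarrow> w \<in> J \<Longrightarrow> adj_form E S (p v) (unit_fun w) = of_bool (v = w)"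
    using indep_cols_dual_functionals[OF assms(1) fJ assms(2,3)] by blast
  obtain h where h: "bij_betw h {..<card J} J"
    using ex_bij_betw_nat_finite[OF fJ] by (auto simp: atLeast0LessThan)
  have hJ: "h i \<in> J" if "i < card J" for i using h that by (auto simp: bij_betw_def)
  have "h i = h j \<longleftrightarrow> i = j" if "i < card J" "j < card J" for i j
    using h that by (auto simp: bij_betw_def inj_on_def)
  then show ?thesis
    by (intro dual_systemsI[of _ "\<lambda>i. p (h i)" _ "\<lambda>i. unit_fun (h i)"])
      (use p hJ assms(2) in \<open>auto intro!: unit_fun_supported\<close>)
qed

lemma adjacency_col_sum:
  assumes vs: "distinct vs" "set vs = S" and I: "I \<subseteq> {..<length vs}" and i: "i < length vs"
  shows "(\<Sum>j\<in>I. c (vs ! j) * (col (adjacency_matrix G vs) j $ i)) =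
    (\<Sum>v\<in>(!) vs ` I. c v * of_bool (vs ! i \<rightarrow>\<^bsub>G\<^esub> v))"
proof -
  have inj: "inj_on ((!) vs) I"
    using vs I by (meson inj_on_nth lessThan_iff subsetD)
  have "(\<Sum>v\<in>(!) vs ` I. c v * of_bool (vs ! i \<rightarrow>\<^bsub>G\<^esub> v)) = (\<Sum>j\<in>I. c (vs ! j) * of_bool (vs ! i \<rightarrow>\<^bsub>G\<^esub> vs ! j))"
    by (simp add: sum.reindex[OF inj])
  also have "\<dots> = (\<Sum>j\<in>I. c (vs ! j) * (col (adjacency_matrix G vs) j $ i))"
    using I i by (intro sum.cong refl) (auto simp: adjacency_matrix_def)
  finally show ?thesis by simp
qed

lemma rank_adjacency_matrix_ge:
  assumes vs: "distinct vs" "set vs = S" and J: "J \<subseteq> S" "indep_cols (\<lambda>u v. u \<rightarrow>\<^bsub>G\<^esub> v) S J"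
  shows "card J \<le> vec_space.rank (length vs) (adjacency_matrix G vs)"
proof -
  let ?n = "length vs" and ?A = "adjacency_matrix G vs"
  interpret vec_space "TYPE(real)" ?n .
  have A: "?A \<in> carrier_mat ?n ?n" by (simp add: adjacency_matrix_def)
  define I where "I = {i. i < ?n \<and> vs ! i \<in> J}"
  have I: "I \<subseteq> {..<?n}" "finite I" by (auto simp: I_def)
  have IJ: "(!) vs ` I = J" using J vs unfolding I_def by (auto simp: image_iff) (metis in_set_conv_nth subsetD)
  have inj: "inj_on ((!) vs) I"
    using vs I by (meson inj_on_nth lessThan_iff subsetD)
  have zero: "\<forall>j\<in>I. c (vs ! j) = 0"
    if c: "\<And>i. i < ?n \<Longrightarrow> (\<Sum>j\<in>I. c (vs ! j) * (col ?A j $ i)) = 0" for c :: "'a \<Rightarrow> real"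
  proof -
    have 0: "(\<Sum>v\<in>J. c v * of_bool (u \<rightarrow>\<^bsub>G\<^esub> v)) = 0" if u: "u \<in> S" for u
    proof -
      obtain i where i: "i < ?n" "u = vs ! i"
        using u unfolding vs(2)[symmetric] by (auto simp: in_set_conv_nth)
      then show ?thesis
        using adjacency_col_sum[OF vs I(1) i(1), of c G] c[OF i(1)] by (simp add: IJ)
    qed
    have "c v = 0" if "v \<in> J" for v
      by (rule indep_colsD[OF J(2), where c = c, OF _ that]) (rule 0)
    then show ?thesis using IJ by blast
  qed
  \<comment> \<open>\<open>lin_indpt\<close> concerns a set of vectors, so repeated columns have to
    be excluded first: they would give a vanishing combination with coefficients 1 and -1.\<close>
  have injc: "inj_on (col ?A) I"
  proof (rule inj_onI, rule ccontr)
    fix j k assume jk: "j \<in> I" "k \<in> I" "col ?A j = col ?A k" "j \<noteq> k"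
    define c where "c v = (if v = vs ! j then 1 else if v = vs ! k then - 1 else (0::real))" for v
    have ne: "vs ! j \<noteq> vs ! k" using inj jk by (auto simp: inj_on_def)
    have "c (vs ! l) * (col ?A l $ i) = (if l = j then col ?A j $ i else 0) + (if l = k then - col ?A k $ i else 0)"
      if "l \<in> I" for l i
      using that jk inj ne by (auto simp: c_def inj_on_def)
    then have "(\<Sum>l\<in>I. c (vs ! l) * (col ?A l $ i)) = 0" for i
      using jk I by (simp add: sum.distrib)
    from zero[OF this] jk(1) have "c (vs ! j) = 0" by blast
    then show False by (simp add: c_def)
  qed
  have sub: "col ?A ` I \<subseteq> set (cols ?A)"
    using I A by (auto simp: cols_def)
  have car: "col ?A ` I \<subseteq> carrier_vec ?n" using sub cols_dim[of ?A] A by auto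
  have "lin_indpt (col ?A ` I)"
  proof (rule finite_lin_indpt2)
    show "finite (col ?A ` I)" using I by simp
    show "col ?A ` I \<subseteq> carrier_vec ?n" by (rule car)
    fix a assume a: "lincomb a (col ?A ` I) = 0\<^sub>v ?n"
    define c where "c v = a (col ?A (the_inv_into I ((!) vs) v))" for v
    have c: "c (vs ! j) = a (col ?A j)" if "j \<in> I" for j
      using that inj by (simp add: c_def the_inv_into_f_f)
    have "(\<Sum>j\<in>I. c (vs ! j) * (col ?A j $ i)) = 0" if "i < ?n" for i
    proof -
      have "(\<Sum>j\<in>I. c (vs ! j) * (col ?A j $ i)) = (\<Sum>x\<in>col ?A ` I. a x * x $ i)"
        by (simp add: sum.reindex[OF injc] c cong: sum.cong)
      also have "\<dots> = lincomb a (col ?A ` I) $ i" using lincomb_index[OF that car] by simp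
      also have "\<dots> = 0" using a that by simp
      finally show ?thesis .
    qed
    from zero[OF this] show "\<forall>v\<in>col ?A ` I. a v = 0" using c by simp
  qed
  from rank_ge_card_indpt[OF A sub this] have "card I \<le> rank ?A" by (simp add: card_image injc)
  then show ?thesis using card_image[OF inj] IJ by simp
qed

text \<open>A maximal independent set of columns has as many elements as the rank; choosing one
  index per vector turns it into a set of vertices.\<close>

lemma rank_adjacency_matrix_attained:
  assumes vs: "distinct vs" "set vs = S"
  obtains J where "J \<subseteq> S" "indep_cols (\<lambda>u v. u \<rightarrow>\<^bsub>G\<^esub> v) S J"
    "card J = vec_space.rank (length vs) (adjacency_matrix G vs)"
proof -
  let ?n = "length vs" and ?A = "adjacency_matrix G vs"
  interpret vec_space "TYPE(real)" ?n .
  have A: "?A \<in> carrier_mat ?n ?n" by (simp add: adjacency_matrix_def)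
  have colsA: "set (cols ?A) = col ?A ` {..<?n}" using A by (auto simp: cols_def)
  have li0: "lin_indpt {}" by (rule finite_lin_indpt2) auto
  obtain T where T: "finite T" "maximal T (\<lambda>T. T \<subseteq> set (cols ?A) \<and> lin_indpt T)"
    using maximal_exists_superset[of "set (cols ?A)" "\<lambda>T. T \<subseteq> set (cols ?A) \<and> lin_indpt T" "{}"] li0 by auto
  have rk: "rank ?A = card T" by (rule rank_card_indpt[OF A T(2)])
  have Ts: "T \<subseteq> col ?A ` {..<?n}" and Tli: "lin_indpt T" using T(2) colsA by (auto simp: maximal_def)
  obtain I where I: "I \<subseteq> {..<?n}" "inj_on (col ?A) I" "T = col ?A ` I"
    using Ts by (meson subset_image_inj)
  have inj: "inj_on ((!) vs) I"
    using vs I by (meson inj_on_nth lessThan_iff subsetD)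
  have car: "T \<subseteq> carrier_vec ?n" using Ts colsA cols_dim[of ?A] A by auto
  show thesis
  proof (rule that[of "(!) vs ` I"])
    show "(!) vs ` I \<subseteq> S" using I vs by auto
    show "card ((!) vs ` I) = rank ?A" using rk I inj by (simp add: card_image)
    show "indep_cols (\<lambda>u v. u \<rightarrow>\<^bsub>G\<^esub> v) S ((!) vs ` I)" unfolding indep_cols_def
    proof (intro allI impI)
      fix c :: "'a \<Rightarrow> real"
      assume c: "\<forall>u\<in>S. (\<Sum>v\<in>(!) vs ` I. c v * of_bool (u \<rightarrow>\<^bsub>G\<^esub> v)) = 0"
      define a where "a t = c (vs ! the_inv_into I (col ?A) t)" for t
      have a: "a (col ?A j) = c (vs ! j)" if "j \<in> I" for j
        using that I by (simp add: a_def the_inv_into_f_f)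
      have "lincomb a T = 0\<^sub>v ?n"
      proof (rule eq_vecI)
        show "dim_vec (lincomb a T) = dim_vec (0\<^sub>v ?n)" using lincomb_dim[OF T(1) car] by simp
        fix i assume "i < dim_vec (0\<^sub>v ?n)"
        then have i: "i < ?n" by simp
        have "lincomb a T $ i = (\<Sum>x\<in>T. a x * x $ i)" by (rule lincomb_index[OF i car])
        also have "\<dots> = (\<Sum>j\<in>I. c (vs ! j) * (col ?A j $ i))"
          unfolding I(3) by (simp add: sum.reindex[OF I(2)] a cong: sum.cong)
        also have "\<dots> = 0" using adjacency_col_sum[OF vs I(1) i, of c G] c nth_mem[OF i] vs(2) by simp
        finally show "lincomb a T $ i = 0\<^sub>v ?n $ i" using i by simp
      qed
      then have "a \<in> T \<rightarrow> {0}" using not_lindepD[OF Tli T(1), of a] by simp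
      then have "a (col ?A j) = 0" if "j \<in> I" for j using that I(3) by blast
      then show "\<forall>v\<in>(!) vs ` I. c v = 0" using a by auto
    qed
  qed
qed

text \<open>Both inequalities hold for every listing of the vertices, in particular for the one
  chosen in \<open>graph_rank\<close>.\<close>

theorem dual_systems_iff_le_graph_rank:
  assumes "finite (verts G)"
  shows "dual_systems (adj_form (\<lambda>u v. u \<rightarrow>\<^bsub>G\<^esub> v) (verts G)) (supported (verts G)) (supported (verts G)) k
    \<longleftrightarrow> k \<le> graph_rank G"
proof -
  let ?d = "dual_systems (adj_form (\<lambda>u v. u \<rightarrow>\<^bsub>G\<^esub> v) (verts G)) (supported (verts G)) (supported (verts G))"
  define vs where "vs = (SOME vs. distinct vs \<and> set vs = verts G)"
  have "\<exists>vs. distinct vs \<and> set vs = verts G" using finite_distinct_list[OF assms] by blast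
  from someI_ex[OF this] have vs: "distinct vs" "set vs = verts G" by (simp_all add: vs_def)
  have rk: "graph_rank G = vec_space.rank (length vs) (adjacency_matrix G vs)"
    unfolding graph_rank_def vs_def[symmetric] using vs distinct_card by metis
  show ?thesis
  proof
    assume "?d k"
    then show "k \<le> graph_rank G"
      unfolding rk using dual_systems_imp_indep_cols[OF assms] rank_adjacency_matrix_ge[OF vs] by metis
  next
    assume k: "k \<le> graph_rank G"
    have "?d (graph_rank G)"
      unfolding rk using rank_adjacency_matrix_attained[OF vs] indep_cols_imp_dual_systems[OF assms] by metis
    then show "?d k" using k by (auto intro: dual_systems_mono)
  qed
qed

text \<open>General spaces \<open>U\<close> are allowed because later arguments use spaces, such as
  \<open>adjoin U g\<close>, that are not spanned by unit vectors.\<close>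

definition form_rank :: "('a \<Rightarrow> 'a \<Rightarrow> bool) \<Rightarrow> 'a set \<Rightarrow> ('a \<Rightarrow> real) set \<Rightarrow> nat" where
  "form_rank E V U = (GREATEST k. dual_systems (adj_form E V) U U k)"

text \<open>Independent columns bound the size of dual systems by \<open>card V\<close>, so a
  greatest size exists.\<close>

lemma le_form_rank_iff:
  assumes "finite V" "U \<subseteq> supported V"
  shows "k \<le> form_rank E V U \<longleftrightarrow> dual_systems (adj_form E V) U U k"
proof -
  let ?d = "dual_systems (adj_form E V) U U"
  have bound: "l \<le> card V" if "?d l" for l
  proof -
    have "dual_systems (adj_form E V) (supported V) (supported V) l"
      using dual_systems_mono[OF that assms(2,2)] by simp
    then show ?thesis
      by (metis dual_systems_imp_indep_cols[OF assms(1)] assms(1) card_mono)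
  qed
  have "?d 0" by (rule dual_systemsI) auto
  then have "?d (form_rank E V U)"
    unfolding form_rank_def using bound by (rule GreatestI_nat)
  moreover have "l \<le> form_rank E V U" if "?d l" for l
    unfolding form_rank_def using that bound by (rule Greatest_le_nat)
  ultimately show ?thesis using dual_systems_mono by blast
qed

lemma dual_systems_form_rank:
  "finite V \<Longrightarrow> U \<subseteq> supported V \<Longrightarrow> dual_systems (adj_form E V) U U (form_rank E V U)"
  using le_form_rank_iff by blast

lemma form_rank_mono:
  assumes "finite V" "U \<subseteq> U'" "U' \<subseteq> supported V"
  shows "form_rank E V U \<le> form_rank E V U'"
  using assms dual_systems_mono[OF dual_systems_form_rank[OF assms(1), of U E] assms(2,2) order_refl]
  by (simp add: le_form_rank_iff)

lemma form_rank_restrict: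
  assumes "finite V" "S \<subseteq> V"
  shows "form_rank E V (supported S) = form_rank E S (supported S)"
proof -
  have "dual_systems (adj_form E V) (supported S) (supported S) k =
      dual_systems (adj_form E S) (supported S) (supported S) k" for k
    by (auto elim!: dual_systems_cong simp: adj_form_restrict[OF assms])
  then show ?thesis by (simp add: form_rank_def)
qed

lemma graph_rank_eq_form_rank:
  assumes "finite (verts G)"
  shows "graph_rank G = form_rank (\<lambda>u v. u \<rightarrow>\<^bsub>G\<^esub> v) (verts G) (supported (verts G))"
  using le_form_rank_iff[OF assms order_refl] dual_systems_iff_le_graph_rank[OF assms]
  by (metis order_antisym order_refl)

section \<open>Symmetric forms and kernel vectors\<close>

definition adjoin :: "('a \<Rightarrow> real) set \<Rightarrow> ('a \<Rightarrow> real) \<Rightarrow> ('a \<Rightarrow> real) set" where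
  "adjoin U g = {(\<lambda>x. f x + c * g x) |f c. f \<in> U}"

lemma adjoin_subset: "U \<subseteq> adjoin U g"
  by (auto simp: adjoin_def intro!: exI[of _ 0])

lemma adjoin_mem: "lin_closed U \<Longrightarrow> g \<in> adjoin U g"
  unfolding adjoin_def using lin_closed_zero[of U] by (auto intro!: exI[of _ "\<lambda>x. 0"] exI[of _ 1])

lemma adjoin_least: "lin_closed W \<Longrightarrow> U \<subseteq> W \<Longrightarrow> g \<in> W \<Longrightarrow> adjoin U g \<subseteq> W"
  unfolding adjoin_def using lin_closedD by blast

lemma lin_closed_adjoin:
  assumes "lin_closed U"
  shows "lin_closed (adjoin U g)"
  unfolding lin_closed_def
proof (intro conjI ballI allI)
  show "(\<lambda>x. 0) \<in> adjoin U g" using adjoin_subset lin_closed_zero[OF assms] by blast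
  fix f h c assume "f \<in> adjoin U g" "h \<in> adjoin U g"
  then obtain f' a h' b where "f' \<in> U" "h' \<in> U" "f = (\<lambda>x. f' x + a * g x)" "h = (\<lambda>x. h' x + b * g x)"
    by (auto simp: adjoin_def)
  moreover have "(\<lambda>x. f' x + c * h' x) \<in> U" using calculation assms lin_closedD by blast
  ultimately show "(\<lambda>x. f x + c * h x) \<in> adjoin U g" unfolding adjoin_def mem_Collect_eq
    by (intro exI[of _ "\<lambda>x. f' x + c * h' x"] exI[of _ "a + c * b"]) (auto simp: algebra_simps)
qed

text \<open>The kernel vector \<open>z\<close> extends the rows and, by symmetry, also the columns of a dual system.\<close>

lemma form_rank_kernel:
  assumes V: "finite V" "symp_on V E" and U': "lin_closed U'" "U' \<subseteq> supported V" and U: "U \<subseteq> U'"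
    and z: "z \<in> U" "\<And>w. w \<in> U \<Longrightarrow> adj_form E V z w = 0"
    and g: "g \<in> U'" "adj_form E V z g \<noteq> 0" and cl: "lin_closed U"
  shows "form_rank E V U + 2 \<le> form_rank E V U'"
proof -
  let ?B = "adj_form E V"
  have sub: "U \<subseteq> supported V" using U U' by blast
  have "dual_systems ?B U U' (Suc (form_rank E V U))"
    by (rule dual_systems_border[OF dual_systems_form_rank[OF V(1) sub] z(2) g(2)])
      (use z g U cl in auto)
  then have "dual_systems (\<lambda>f g. ?B g f) U' U (Suc (form_rank E V U))" by (rule dual_systems_transpose)
  then have "dual_systems ?B U' U (Suc (form_rank E V U))"
    by (rule dual_systems_cong) (rule adj_form_swap[OF V(2)])
  then have "dual_systems ?B U' U' (Suc (Suc (form_rank E V U)))"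
    by (rule dual_systems_border[OF _ z(2) g(2)]) (use z g U U' in auto)
  then show ?thesis by (simp add: le_form_rank_iff[OF V(1) U'(2)])
qed

section \<open>The bound\<close>

text \<open>The function \<open>m(r) + 2\<close>, which doubles when \<open>r\<close> grows by two. Its value at \<open>1\<close>, which is
  not the rank of a graph, is chosen so that it is a monotone function into the naturals.\<close>

fun mu :: "nat \<Rightarrow> nat" where
  "mu 0 = 2"
| "mu (Suc 0) = 2"
| "mu (Suc (Suc 0)) = 4"
| "mu (Suc (Suc (Suc 0))) = 5"
| "mu (Suc (Suc n)) = 2 * mu n"

lemma mu_small: "mu 0 = 2" "mu 1 = 2" "mu 2 = 4" "mu 3 = 5" "mu 4 = 8" "mu 5 = 10" "mu 6 = 16"
    "mu 7 = 20" "mu 8 = 32" "mu 9 = 40"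
  by (simp_all add: numeral_eq_Suc)

text \<open>The exception is \<open>n = 1\<close>, where \<open>mu 3 = 5\<close> exceeds
  \<open>2 * mu 1 = 4\<close>.\<close>

lemma mu_add2: "n \<noteq> 1 \<Longrightarrow> mu (n + 2) = 2 * mu n"
  by (cases n rule: mu.cases) auto

lemma mu_minus2: "2 \<le> n \<Longrightarrow> n \<noteq> 3 \<Longrightarrow> mu n = 2 * mu (n - 2)"
  using mu_add2[of "n - 2"] by (simp only: le_add_diff_inverse2)

lemma mu_double_le: "2 * mu n \<le> mu (n + 2)"
  by (cases n rule: mu.cases) auto

lemma mu_ge2: "2 \<le> mu n"
  by (induction n rule: mu.induct) auto

lemma mu_less_Suc: "2 \<le> n \<Longrightarrow> mu n < mu (Suc n)"
  by (induction n rule: mu.induct) auto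

lemma mu_mono: "m \<le> n \<Longrightarrow> mu m \<le> mu n"
proof (rule lift_Suc_mono_le[of mu])
  fix k show "mu k \<le> mu (Suc k)"
  proof (cases "2 \<le> k")
    case False
    then have "k = 0 \<or> k = 1" by auto
    then show ?thesis by auto
  qed (simp add: mu_less_Suc less_imp_le)
qed

lemma mu_eq_m_bound: "2 \<le> n \<Longrightarrow> real (mu n) = m_bound (int n) + 2"
proof (induction n rule: less_induct)
  case (less n)
  consider "n = 2" | "n = 3" | "n \<ge> 4" using less.prems by linarith
  then show ?case
  proof cases
    case 3
    define m where "m = n - 2"
    have m: "n = m + 2" "2 \<le> m" "m < n" using 3 by (auto simp: m_def)
    have "m_bound (int n) + 2 = 2 * (m_bound (int m) + 2)"
    proof (cases "even m")
      case True
      then obtain k where "m = 2 * k" by blast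
      then have "(int n + 2) div 2 = int k + 2" "(int m + 2) div 2 = int k + 1" "even (int n)" "even (int m)"
        using m(1) by auto
      then show ?thesis unfolding m_bound_def by (simp add: power_int_add)
    next
      case False
      then obtain k where "m = 2 * k + 1" using oddE by blast
      then have "(int n - 3) div 2 = int k" "(int m - 3) div 2 = int k - 1" "odd (int n)" "odd (int m)"
        using m(1) by auto
      then show ?thesis unfolding m_bound_def by (simp add: power_int_diff)
    qed
    then show ?thesis using less.IH[OF m(3,2)] mu_add2[of m] m by simp
  qed (auto simp: m_bound_def mu_small)
qed

text \<open>Meant for two graphs not joined by edges, whose ranks add. Lowering \<open>y\<close> by
  two subtracts \<open>mu (y - 2)\<close> on the left and \<open>mu (x + y - 4)\<close>, which is at
  least as large, on the right.\<close>

lemma mu_add_le: "2 \<le> x \<Longrightarrow> 2 \<le> y \<Longrightarrow> mu x + mu y \<le> mu (x + y - 2) + 4"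
proof (induction y rule: less_induct)
  case (less y)
  consider "y = 2" | "y = 3" | "y \<ge> 4" using less.prems by linarith
  then show ?case
  proof cases
    case 2
    then show ?thesis using mu_less_Suc[OF less.prems(1)] by (simp add: mu_small)
  next
    case 3
    have y: "mu y = 2 * mu (y - 2)" "mu (x + y - 2) = 2 * mu (x + (y - 2) - 2)"
      using 3 less.prems mu_minus2[of y] mu_minus2[of "x + y - 2"] by simp_all
    have "mu x + mu (y - 2) \<le> mu (x + (y - 2) - 2) + 4" using less.IH[of "y - 2"] 3 less.prems by simp
    moreover have "mu (y - 2) \<le> mu (x + (y - 2) - 2)" using less.prems by (intro mu_mono) simp
    ultimately show ?thesis using y by simp
  qed (simp add: mu_small)
qed

text \<open>In both applications \<open>x + y = r + 1\<close>, so that \<open>11 \<le> x + y\<close>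
  amounts to \<open>10 \<le> r\<close>. For \<open>x = 4\<close> and \<open>y = 6\<close> the two
  sides would be equal.\<close>

lemma mu_add_less:
  "4 \<le> x \<Longrightarrow> 4 \<le> y \<Longrightarrow> 11 \<le> x + y \<Longrightarrow> mu x + mu y < mu (x + y - 3) + 4"
proof (induction "x + y" arbitrary: x y rule: less_induct)
  case less
  have step: "mu x + mu y < mu (x + y - 3) + 4"
    if xy: "4 \<le> x" "6 \<le> y" "13 \<le> x + y" "mu x + mu (y - 2) < mu (x + (y - 2) - 3) + 4" for x y
  proof -
    have y: "mu y = 2 * mu (y - 2)" "mu (x + y - 3) = 2 * mu (x + (y - 2) - 3)"
      using xy mu_minus2[of y] mu_minus2[of "x + y - 3"] by simp_all
    moreover have "mu (y - 2) \<le> mu (x + (y - 2) - 3)" using xy by (intro mu_mono) simp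
    ultimately show ?thesis using xy by simp
  qed
  consider "x + y \<ge> 13" "y \<ge> 6" | "x + y \<ge> 13" "x \<ge> 6" | "x + y = 11 \<or> x + y = 12"
    using less.prems by linarith
  then show ?case
  proof cases
    case 1
    then show ?thesis using step[of x y] less.hyps[of x "y - 2"] less.prems by simp
  next
    case 2
    then show ?thesis using step[of y x] less.hyps[of y "x - 2"] less.prems by (simp add: add.commute)
  next
    case 3
    then have "x = 4 \<or> x = 5 \<or> x = 6 \<or> x = 7 \<or> x = 8" and "y = 11 - x \<or> y = 12 - x" and "4 \<le> y"
      using less.prems by linarith+
    then show ?thesis by (elim disjE; simp add: mu_small)
  qed
qed

section \<open>Minimal counterexamples\<close>

definition nbh :: "('a \<Rightarrow> 'a \<Rightarrow> bool) \<Rightarrow> 'a set \<Rightarrow> 'a \<Rightarrow> 'a set" where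
  "nbh E S v = {u \<in> S. E v u}"

definition reduced_on :: "('a \<Rightarrow> 'a \<Rightarrow> bool) \<Rightarrow> 'a set \<Rightarrow> bool" where
  "reduced_on E S \<longleftrightarrow> (\<forall>v\<in>S. nbh E S v \<noteq> {}) \<and> inj_on (nbh E S) S"

text \<open>Every neighbour of a vertex of \<open>R\<close> can be replaced by a representative with
  the same neighbours in \<open>S\<close>; hence the neighbourhood in \<open>R\<close> determines
  the one in \<open>S\<close>.\<close>

lemma reduced_on_representatives:
  assumes sym: "\<And>u v. E u v \<Longrightarrow> E v u"
    and R: "R \<subseteq> S" "\<And>v. v \<in> R \<Longrightarrow> nbh E S v \<noteq> {}" "inj_on (nbh E S) R"
    and rep: "\<And>v. v \<in> S \<Longrightarrow> nbh E S v \<noteq> {} \<Longrightarrow> \<exists>t\<in>R. nbh E S t = nbh E S v"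
  shows "reduced_on E R"
proof -
  have closed: "\<exists>t\<in>R. \<forall>u\<in>S. E u t = E u y" if y: "y \<in> S" "E v y" "v \<in> S" for v y
  proof -
    have "nbh E S y \<noteq> {}" using y sym by (auto simp: nbh_def)
    then obtain t where t: "t \<in> R" "nbh E S t = nbh E S y" using rep y(1) by blast
    have "E u t = E u y" if "u \<in> S" for u using t(2) that sym by (auto simp: nbh_def)
    then show ?thesis using t by blast
  qed
  have eq: "nbh E S u \<subseteq> nbh E S v" if uv: "nbh E R u = nbh E R v" "u \<in> R" "v \<in> R" for u v
  proof
    fix y assume "y \<in> nbh E S u"
    then have y: "y \<in> S" "E u y" by (auto simp: nbh_def)
    then obtain t where t: "t \<in> R" "\<forall>u\<in>S. E u t = E u y" using closed[of y u] uv(2) R(1) by blast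
    then have "t \<in> nbh E R u" using y that R by (auto simp: nbh_def)
    then have "E v t" using that by (auto simp: nbh_def)
    then show "y \<in> nbh E S v" using t y that R by (auto simp: nbh_def)
  qed
  have "nbh E R v \<noteq> {}" if v: "v \<in> R" for v
  proof -
    obtain y where "y \<in> S" "E v y" using R(2)[OF v] by (auto simp: nbh_def)
    then obtain t where "t \<in> R" "E v t" using closed[of y v] v R(1) by blast
    then show ?thesis by (auto simp: nbh_def)
  qed
  moreover have "inj_on (nbh E R) R"
    using eq R(3) by (intro inj_onI) (metis inj_onD subset_antisym)
  ultimately show ?thesis by (simp add: reduced_on_def)
qed

text \<open>Two non-adjacent vertices would both have the third one as their only neighbour.\<close>

lemma reduced_on_3_clique:
  assumes "card S = 3" "reduced_on E S" "\<And>u v. E u v \<Longrightarrow> E v u" "\<And>u. \<not> E u u" "u \<in> S" "v \<in> S" "u \<noteq> v"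
  shows "E u v"
proof (rule ccontr)
  assume n: "\<not> E u v"
  have "card (S - {u, v}) = 1" using assms(1,5-7) by (simp add: card_Diff_subset)
  then obtain w where "S - {u, v} = {w}" by (metis card_1_singletonE)
  then have S: "S = {u, v, w}" using assms(5,6) by blast
  have "E u w" "E v w"
    using assms(2,4,7) n assms(3) unfolding S by (auto simp: reduced_on_def nbh_def)
  then have "nbh E S u = nbh E S v" using n assms(3,4) unfolding S by (auto simp: nbh_def)
  then show False using assms(2,5-7) by (auto simp: reduced_on_def inj_on_def)
qed

text \<open>As \<open>mu r\<close> is \<open>m(r) + 2\<close>, \<open>big\<close> says that the
  order exceeds \<open>m(r)\<close>. Minimality enters only through \<open>small\<close>, for proper
  induced subgraphs.\<close>

locale minimal_counterexample =
  fixes V :: "'a set" and E :: "'a \<Rightarrow> 'a \<Rightarrow> bool" and r :: nat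
  assumes finV: "finite V"
    and sym: "\<And>u v. E u v \<Longrightarrow> E v u" and irr: "\<And>u. \<not> E u u"
    and redV: "reduced_on E V"
    and rankV: "form_rank E V (supported V) = r" and r10: "10 \<le> r"
    and big: "mu r \<le> card V + 1"
    and small: "\<And>S. S \<subset> V \<Longrightarrow> S \<noteq> {} \<Longrightarrow> reduced_on E S \<Longrightarrow>
      2 \<le> form_rank E V (supported S) \<Longrightarrow> card S + 2 \<le> mu (form_rank E V (supported S))"
begin

abbreviation "B \<equiv> adj_form E V"
abbreviation "rk S \<equiv> form_rank E V (supported S)"

lemma symp: "symp_on V E" using sym by (auto intro: symp_onI)

lemma sym_iff: "E u v = E v u" using sym by blast

lemma B_swap: "B f g = B g f" by (rule adj_form_swap[OF symp])

lemma B_units: "u \<in> V \<Longrightarrow> v \<in> V \<Longrightarrow> B (unit_fun u) (unit_fun v) = of_bool (E u v)"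
  by (rule adj_form_units[OF finV])

lemma B_expand: "S \<subseteq> V \<Longrightarrow> g \<in> supported S \<Longrightarrow> B f g = (\<Sum>v\<in>S. g v * B f (unit_fun v))"
  by (subst supported_expand[of S g]) (use finV finite_subset in \<open>auto simp: adj_form_sum_right\<close>)

lemma B_zeroI:
  assumes "S \<subseteq> V" "g \<in> supported S" "\<And>v. v \<in> S \<Longrightarrow> B f (unit_fun v) = 0"
  shows "B f g = 0"
  using B_expand[OF assms(1,2)] assms(3) by simp

lemma rk_mono: "S \<subseteq> S' \<Longrightarrow> S' \<subseteq> V \<Longrightarrow> rk S \<le> rk S'"
  using finV by (intro form_rank_mono supported_mono) auto

lemma edge_rank: assumes "S \<subseteq> V" "u \<in> S" "v \<in> S" "E u v" shows "2 \<le> rk S"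
proof -
  have uv: "u \<in> V" "v \<in> V" using assms by auto
  have "dual_systems B (supported S) (supported S) 2"
    by (rule dual_systemsI[of _ "\<lambda>i. if i = 0 then unit_fun u else unit_fun v" _ "\<lambda>i. if i = 0 then unit_fun v else unit_fun u"])
      (use assms uv irr sym in \<open>auto simp: B_units unit_fun_supported\<close>)
  then show ?thesis using le_form_rank_iff[OF finV supported_mono[OF assms(1)]] by blast
qed

text \<open>A nonempty reduced graph has an edge and hence rank at least 2, so \<open>small\<close>
  applies; for the empty graph \<open>mu\<close> is large enough.\<close>

lemma card_reduced:
  assumes "S \<subset> V" "reduced_on E S"
  shows "card S + 2 \<le> mu (rk S)"
proof (cases "S = {}")
  case True
  then show ?thesis using mu_ge2[of "rk S"] by simp
next
  case False
  then obtain v where "v \<in> S" by blast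
  then obtain u where "u \<in> S" "E v u" using assms(2) by (auto simp: reduced_on_def nbh_def)
  then have "2 \<le> rk S" using \<open>v \<in> S\<close> assms(1) by (intro edge_rank[of S v u]) auto
  then show ?thesis using small[OF assms(1) False assms(2)] by blast
qed

lemma kernel_rank:
  assumes "lin_closed U" "lin_closed U'" "U' \<subseteq> supported V" "U \<subseteq> U'" "z \<in> U"
    "\<And>w. w \<in> U \<Longrightarrow> B z w = 0" "g \<in> U'" "B z g \<noteq> 0"
  shows "form_rank E V U + 2 \<le> form_rank E V U'"
  using form_rank_kernel[OF finV symp assms(2,3,4,5,6,7,8,1)] by blast

end

text \<open>\<open>a, b\<close> is one pair of duplicated vertices of \<open>H\<close>. \<open>X\<close> is the set of removed vertices, so
  that \<open>\<tau> = |X|\<close>, and \<open>Du\<close>, \<open>Is\<close>, \<open>D\<close> are the duplicated, the isolated and the remaining vertices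
  of \<open>H\<close>.\<close>

locale dup_subgraph = minimal_counterexample V E r for V :: "'a set" and E and r +
  fixes H :: "'a set" and a b :: 'a
  assumes HV: "H \<subseteq> V"
    and ab: "a \<in> H" "b \<in> H" "a \<noteq> b" "nbh E H a = nbh E H b"
    and tau_min: "\<And>u v. u \<in> V \<Longrightarrow> v \<in> V \<Longrightarrow> u \<noteq> v \<Longrightarrow> \<not> E u v \<Longrightarrow>
      card (V - H) \<le> card {x \<in> V. E u x \<noteq> E v x}"
    and rankH: "r \<le> form_rank E V (supported H) + 3"
begin

section \<open>Structure of the duplicated and isolated vertices of \<open>H\<close>\<close>

definition "X = V - H"
definition "Du = {v \<in> H. \<exists>u\<in>H. u \<noteq> v \<and> nbh E H u = nbh E H v}"
definition "Is = {v \<in> H. nbh E H v = {}}"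
definition "D = H - Du - Is"
definition dv :: "'a \<Rightarrow> 'a \<Rightarrow> 'a \<Rightarrow> real" where "dv u v = (\<lambda>x. unit_fun u x - unit_fun v x)"

lemma XV: "X \<subseteq> V" "X \<inter> H = {}" "V = X \<union> H" "finite X" "finite H" "finite Du" "finite Is" "finite D"
  using finV HV by (auto simp: X_def Du_def Is_def D_def intro: finite_subset)

lemma dup_adj: "nbh E H u = nbh E H v \<Longrightarrow> y \<in> H \<Longrightarrow> E u y = E v y"
  by (auto simp: nbh_def)

lemma dup_nonadj: "nbh E H u = nbh E H v \<Longrightarrow> u \<in> H \<Longrightarrow> v \<in> H \<Longrightarrow> \<not> E u v"
  using irr by (auto simp: nbh_def)

text \<open>Duplicated vertices of \<open>H\<close> differ only on \<open>X\<close>, and by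
  \<open>tau_min\<close> in at least \<open>card X\<close> places.\<close>

lemma dup_X:
  assumes "u \<in> H" "v \<in> H" "u \<noteq> v" "nbh E H u = nbh E H v" "x \<in> X"
  shows "E u x \<noteq> E v x"
proof -
  have "{x \<in> V. E u x \<noteq> E v x} \<subseteq> X"
    using assms dup_adj[OF assms(4)] by (auto simp: X_def)
  moreover have "card X \<le> card {x \<in> V. E u x \<noteq> E v x}"
    unfolding X_def using assms HV dup_nonadj by (intro tau_min) auto
  ultimately have "{x \<in> V. E u x \<noteq> E v x} = X" using XV by (intro card_seteq) auto
  then show ?thesis using assms by blast
qed

lemma X_nonempty: "X \<noteq> {}"
proof
  assume "X = {}"
  then have "H = V" using HV by (auto simp: X_def)
  then show False using redV ab by (auto simp: reduced_on_def inj_on_def)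
qed

text \<open>Three duplicated vertices would need three different adjacencies to one vertex of
  \<open>X\<close>, but there are only two.\<close>

lemma dup_class_2:
  assumes "u \<in> H" "v \<in> H" "w \<in> H" "nbh E H u = nbh E H v" "nbh E H u = nbh E H w" "u \<noteq> v" "u \<noteq> w"
  shows "v = w"
  using dup_X X_nonempty assms by (metis all_not_in_conv)

lemma B_dv: "u \<in> V \<Longrightarrow> v \<in> V \<Longrightarrow> x \<in> V \<Longrightarrow> B (dv u v) (unit_fun x) = of_bool (E u x) - of_bool (E v x)"
  by (simp add: dv_def adj_form_minus B_units)

lemma dv_supported: "u \<in> S \<Longrightarrow> v \<in> S \<Longrightarrow> dv u v \<in> supported S"
  by (auto simp: dv_def supported_def unit_fun_def)

lemma dv_kernel:
  assumes "u \<in> H" "v \<in> H" "nbh E H u = nbh E H v" "g \<in> supported H"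
  shows "B (dv u v) g = 0"
  by (rule B_zeroI[OF HV assms(4)]) (use assms HV dup_adj[OF assms(3)] in \<open>auto simp: B_dv subset_eq\<close>)

lemma supp_HV: "supported H \<subseteq> supported V" by (rule supported_mono[OF HV])

text \<open>\<open>dv a b\<close> is a kernel vector of \<open>H\<close> with nonzero image on
  \<open>X\<close>, which costs two ranks by \<open>kernel_rank\<close>.\<close>

lemma rk_H: "rk H + 2 \<le> r"
proof -
  obtain x where x: "x \<in> X" using X_nonempty by blast
  have "B (dv a b) (unit_fun x) \<noteq> 0"
    using dup_X[OF ab x] ab HV x XV by (subst B_dv) auto
  then have "rk H + 2 \<le> rk V"
    by (intro kernel_rank[OF lin_closed_supported lin_closed_supported order_refl supp_HV, of "dv a b" "unit_fun x"])
      (use ab x XV in \<open>auto intro!: dv_supported dv_kernel unit_fun_supported\<close>)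
  then show ?thesis using rankV by simp
qed

text \<open>The rank of \<open>H\<close> is at least \<open>r - 3\<close>, hence two vectors of its kernel have parallel images
  on \<open>X\<close>: otherwise the rank would drop by four.\<close>

lemma kernel_parallel:
  assumes z: "z \<in> supported H" "\<And>g. g \<in> supported H \<Longrightarrow> B z g = 0"
    and z': "z' \<in> supported H" "\<And>g. g \<in> supported H \<Longrightarrow> B z' g = 0"
    and xy: "x \<in> X" "y \<in> X"
  shows "B z (unit_fun x) * B z' (unit_fun y) = B z (unit_fun y) * B z' (unit_fun x)"
proof (rule ccontr)
  assume ne: "\<not> ?thesis"
  \<comment> \<open>This combination is orthogonal to \<open>z'\<close> but not to \<open>z\<close>:
    adjoining it to \<open>H\<close> gains two ranks through \<open>z\<close>, and passing on to
    \<open>V\<close> gains two more through \<open>z'\<close>.\<close>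
  define g where "g = (\<lambda>v. B z' (unit_fun y) * unit_fun x v + (- B z' (unit_fun x)) * unit_fun y v)"
  have gV: "g \<in> supported V"
    unfolding g_def using xy XV by (intro lin_closedD lin_closed_scale lin_closed_supported unit_fun_supported) auto
  have zg: "B z g \<noteq> 0"
    unfolding g_def adj_form_right adj_form_scale using ne by (simp add: mult.commute)
  have z'g: "B z' g = 0"
    unfolding g_def adj_form_right adj_form_scale by (simp add: mult.commute)
  define U where "U = adjoin (supported H) g"
  have U: "lin_closed U" "supported H \<subseteq> U" "U \<subseteq> supported V" "g \<in> U"
    unfolding U_def using gV supp_HV
    by (auto intro: lin_closed_adjoin lin_closed_supported adjoin_subset[THEN subsetD] adjoin_mem
        adjoin_least[OF lin_closed_supported, THEN subsetD])
  have 1: "rk H + 2 \<le> form_rank E V U"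
    by (rule kernel_rank[OF lin_closed_supported U(1,3,2) z(1,2) U(4) zg])
  have z'U: "B z' w = 0" if "w \<in> U" for w
    using that z'(2) z'g by (auto simp: U_def adjoin_def adj_form_right)
  have "B z' (unit_fun x) \<noteq> 0 \<or> B z' (unit_fun y) \<noteq> 0" using ne by auto
  then obtain x' where x': "x' \<in> X" "B z' (unit_fun x') \<noteq> 0" using xy by blast
  have "form_rank E V U + 2 \<le> rk V"
    by (rule kernel_rank[OF U(1) lin_closed_supported order_refl U(3) _ z'U _ x'(2)])
      (use z'(1) U(2) x' XV in \<open>auto intro: unit_fun_supported\<close>)
  then show False using 1 rankV rankH by linarith
qed

text \<open>The images of \<open>dv a b\<close> and \<open>dv u v\<close> on \<open>X\<close> have
  entries 1 and -1, so being parallel they agree up to a global sign.\<close>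

lemma dup_sides:
  assumes uv: "u \<in> H" "v \<in> H" "u \<noteq> v" "nbh E H u = nbh E H v" and xy: "x \<in> X" "y \<in> X"
  shows "E u x = E a x \<longleftrightarrow> E u y = E a y"
proof -
  have "B (dv a b) (unit_fun x) * B (dv u v) (unit_fun y) = B (dv a b) (unit_fun y) * B (dv u v) (unit_fun x)"
    using uv ab xy by (intro kernel_parallel) (auto intro: dv_supported dv_kernel)
  moreover have "a \<in> V" "b \<in> V" "u \<in> V" "v \<in> V" "x \<in> V" "y \<in> V" using uv ab xy XV by auto
  ultimately show ?thesis
    using dup_X[OF uv xy(1)] dup_X[OF uv xy(2)] dup_X[OF ab xy(1)] dup_X[OF ab xy(2)]
    by (auto simp: B_dv split: if_splits)
qed

text \<open>The unit vector of \<open>w\<close> also lies in the kernel of \<open>H\<close>. Its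
  image on \<open>X\<close> is a nonzero 0-1 vector parallel to the image of \<open>dv a b\<close>
  with entries 1 and -1, so both images are constant.\<close>

lemma isolated_nbh:
  assumes w: "w \<in> Is"
  shows "x \<in> X \<Longrightarrow> E w x" and "x \<in> X \<Longrightarrow> y \<in> X \<Longrightarrow> E a x = E a y"
proof -
  have wH: "w \<in> H" "w \<in> V" "nbh E H w = {}" using w HV by (auto simp: Is_def)
  obtain x0 where "x0 \<in> V" "E w x0" using redV wH by (auto simp: reduced_on_def nbh_def)
  then have x0: "x0 \<in> X" "E w x0" using wH by (auto simp: X_def nbh_def)
  have eq: "B (dv a b) (unit_fun x0) * B (unit_fun w) (unit_fun y) = B (dv a b) (unit_fun y) * B (unit_fun w) (unit_fun x0)"
    if "y \<in> X" for y
  proof (rule kernel_parallel)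
    show "B (unit_fun w) g = 0" if "g \<in> supported H" for g
      by (rule B_zeroI[OF HV that]) (use wH HV in \<open>auto simp: B_units subset_eq nbh_def\<close>)
  qed (use ab wH x0 that in \<open>auto intro: dv_supported dv_kernel unit_fun_supported\<close>)
  have V: "a \<in> V" "b \<in> V" "x0 \<in> V" using ab x0 XV by auto
  have *: "E w y \<and> E a y = E a x0" if y: "y \<in> X" for y
  proof -
    have "y \<in> V" using y XV by auto
    then show ?thesis using eq[OF y] V wH x0 dup_X[OF ab x0(1)] dup_X[OF ab y]
      by (cases "E w y") (auto simp: B_dv B_units split: if_splits)
  qed
  show "x \<in> X \<Longrightarrow> E w x" and "x \<in> X \<Longrightarrow> y \<in> X \<Longrightarrow> E a x = E a y" using * by auto
qed

text \<open>Two isolated vertices would be duplicated although both are adjacent to all of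
  \<open>X\<close>, contrary to \<open>dup_X\<close>.\<close>

lemma Is_unique: "w \<in> Is \<Longrightarrow> w' \<in> H \<Longrightarrow> nbh E H w' = nbh E H w \<Longrightarrow> w' = w"
  using isolated_nbh(1) dup_X X_nonempty unfolding Is_def by (metis (no_types, lifting) all_not_in_conv mem_Collect_eq)

lemma Is_Du: "Is \<inter> Du = {}"
  using Is_unique by (auto simp: Du_def)

lemma card_Is: "card Is \<le> 1"
  using Is_unique XV(7) by (intro card_le_Suc0_iff_eq[THEN iffD2, THEN order_trans]) (auto simp: Is_def)

lemma card_V: "card V = card X + card D + card Du + card Is"
proof -
  have "card V = card X + card H" using XV card_Un_disjoint[of X H] by auto
  moreover have "card H = card (D \<union> Du \<union> Is)" by (rule arg_cong[of _ _ card]) (auto simp: D_def Du_def Is_def)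
  moreover have "card (D \<union> Du \<union> Is) = card D + card Du + card Is"
    using XV Is_Du by (subst card_Un_disjoint; (subst card_Un_disjoint)?) (auto simp: D_def)
  ultimately show ?thesis by simp
qed

end

section \<open>Representatives of the pairs, counting and absence of duplicates\<close>

locale dup_reps = dup_subgraph V E r H a b for V :: "'a set" and E r H a b +
  fixes T :: "'a set"
  assumes TDu: "T \<subseteq> Du"
    and rep: "\<And>v. v \<in> Du \<Longrightarrow> \<exists>!t. t \<in> T \<and> nbh E H t = nbh E H v"
begin

lemma finT: "finite T" using TDu XV finite_subset by blast

lemma TH: "T \<subseteq> H" using TDu by (auto simp: Du_def)

lemma TV: "T \<subseteq> V" using TH HV by blast

lemma sub_H_psubset: "S \<subseteq> H \<Longrightarrow> S \<subset> V"
  using X_nonempty HV unfolding X_def by auto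

lemma DuH: "Du \<subseteq> H" by (auto simp: Du_def)

lemma T_unique: "t \<in> T \<Longrightarrow> t' \<in> T \<Longrightarrow> nbh E H t = nbh E H t' \<Longrightarrow> t = t'"
  using rep[of t'] TDu by auto

definition partner :: "'a \<Rightarrow> 'a" where
  "partner v = (SOME u. u \<in> H \<and> u \<noteq> v \<and> nbh E H u = nbh E H v)"

lemma partner:
  assumes "v \<in> Du"
  shows "partner v \<in> H" "partner v \<noteq> v" "nbh E H (partner v) = nbh E H v"
proof -
  have "\<exists>u. u \<in> H \<and> u \<noteq> v \<and> nbh E H u = nbh E H v" using assms unfolding Du_def by auto
  from someI_ex[OF this] show "partner v \<in> H" "partner v \<noteq> v" "nbh E H (partner v) = nbh E H v"
    unfolding partner_def[symmetric] by auto
qed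

lemma partner_Du:
  assumes "v \<in> Du"
  shows "partner v \<in> Du"
proof -
  have "v \<in> H" using assms DuH by blast
  then show ?thesis unfolding Du_def
    by (intro CollectI conjI bexI[of _ v]) (use partner[OF assms] in auto)
qed

lemma Du_cases:
  assumes "v \<in> Du"
  obtains t where "t \<in> T" "nbh E H t = nbh E H v" "v = t \<or> v = partner t"
proof -
  obtain t where t: "t \<in> T" "nbh E H t = nbh E H v" using rep[OF assms] by blast
  then have tD: "t \<in> Du" "t \<in> H" using TDu TH by auto
  have "v = t \<or> v = partner t"
    using dup_class_2[of t v "partner t"] partner[OF tD(1)] tD t(2) DuH assms by auto
  then show thesis using that t by blast
qed

lemma card_Du: "card Du = 2 * card T"
proof -
  have "Du = T \<union> partner ` T"
  proof
    show "Du \<subseteq> T \<union> partner ` T" by (auto elim: Du_cases)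
    show "T \<union> partner ` T \<subseteq> Du" using TDu partner_Du by auto
  qed
  moreover have "T \<inter> partner ` T = {}"
  proof -
    have "partner t \<notin> T" if "t \<in> T" for t
      using T_unique[of "partner t" t] partner[of t] that TDu by blast
    then show ?thesis by blast
  qed
  moreover have "inj_on partner T"
  proof (rule inj_onI)
    fix t t' assume t: "t \<in> T" "t' \<in> T" "partner t = partner t'"
    then have "nbh E H t = nbh E H t'" using partner(3)[of t] partner(3)[of t'] TDu by auto
    then show "t = t'" using T_unique t by blast
  qed
  ultimately show ?thesis using finT by (simp add: card_Un_disjoint card_image)
qed

lemma T_nonempty: "T \<noteq> {}"
proof -
  have "a \<in> Du" using ab by (auto simp: Du_def)
  then show ?thesis using rep by blast
qed

text \<open>\<open>D \<union> T\<close> represents every nonempty neighbourhood in \<open>H\<close>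
  exactly once, so it is reduced, and its rank is at most that of \<open>H\<close>.\<close>

lemma card_D_T: "card D + card T + 2 \<le> mu (r - 2)"
proof -
  have "reduced_on E (D \<union> T)"
  proof (rule reduced_on_representatives[of E _ H, OF sym])
    show "D \<union> T \<subseteq> H" using TH by (auto simp: D_def)
    show "nbh E H v \<noteq> {}" if "v \<in> D \<union> T" for v
      using that TDu Is_Du TH by (auto simp: D_def Is_def)
    show "inj_on (nbh E H) (D \<union> T)"
    proof (rule inj_onI, rule ccontr)
      fix u v assume uv: "u \<in> D \<union> T" "v \<in> D \<union> T" "nbh E H u = nbh E H v" "u \<noteq> v"
      then have "u \<in> Du" "v \<in> Du" using TH by (auto simp: D_def Du_def)
      then show False using uv T_unique by (auto simp: D_def)
    qed
    show "\<exists>t\<in>D \<union> T. nbh E H t = nbh E H v" if "v \<in> H" "nbh E H v \<noteq> {}" for v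
      using that rep[of v] by (cases "v \<in> Du") (auto simp: D_def Is_def)
  qed
  moreover have sub: "D \<union> T \<subseteq> H" using TH by (auto simp: D_def)
  ultimately have "card (D \<union> T) + 2 \<le> mu (rk (D \<union> T))" by (intro card_reduced sub_H_psubset)
  moreover have "rk (D \<union> T) \<le> r - 2"
    using rk_mono[OF sub HV] rk_H by linarith
  then have "mu (rk (D \<union> T)) \<le> mu (r - 2)" by (rule mu_mono)
  moreover have "card (D \<union> T) = card D + card T"
    using XV finT TDu by (intro card_Un_disjoint) (auto simp: D_def)
  ultimately show ?thesis by linarith
qed

text \<open>Each pair counts twice in \<open>card V\<close>, and \<open>mu r\<close> is twice
  \<open>mu (r - 2)\<close>; removing one copy of the bound \<open>card_D_T\<close> leaves the other
  half.\<close>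

lemma count_X: "mu (r - 2) + 1 \<le> card X + card T + card Is"
proof -
  have "mu r = 2 * mu (r - 2)" using r10 by (intro mu_minus2) auto
  then show ?thesis using card_D_T big card_V card_Du by linarith
qed

lemma count_D: "card D + 3 \<le> card X + card Is"
  using count_X card_D_T by linarith

lemma side_cases:
  assumes "v \<in> Du"
  shows "(\<forall>x\<in>X. E v x = E a x) \<or> (\<forall>x\<in>X. E v x \<noteq> E a x)"
proof -
  obtain x0 where x0: "x0 \<in> X" using X_nonempty by blast
  have "E v x = E a x \<longleftrightarrow> E v x0 = E a x0" if "x \<in> X" for x
    using dup_sides[of v "partner v" x x0] partner[OF assms] assms DuH that x0 by auto
  then show ?thesis by blast
qed

text \<open>Some vertex of the pair of \<open>t'\<close> agrees with \<open>t\<close> on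
  \<open>X\<close>. It differs from \<open>t\<close> only on \<open>D\<close> and on both members of
  the pairs whose representative separates \<open>t\<close> from \<open>t'\<close>.\<close>

lemma T_dist:
  assumes t: "t \<in> T" "t' \<in> T" "t \<noteq> t'" "\<not> E t t'"
  shows "card X \<le> card D + 2 * card {y \<in> T. E t y \<noteq> E t' y}"
proof -
  define W where "W = {y \<in> T. E t y \<noteq> E t' y}"
  have Du: "t \<in> Du" "t' \<in> Du" "t \<in> H" "t' \<in> H" using t TDu TH by auto
  note p = partner[OF Du(2)]
  obtain x0 where x0: "x0 \<in> X" using X_nonempty by blast
  define t'' where "t'' = (if E t' x0 = E t x0 then t' else partner t')"
  have t'': "t'' \<in> H" "nbh E H t'' = nbh E H t'" using p Du by (auto simp: t''_def)
  have t''D: "t'' \<in> Du" using partner_Du Du by (auto simp: t''_def)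
  have "E t'' x0 = E t x0" using p Du dup_X[of t' "partner t'" x0] x0 by (auto simp: t''_def)
  then have X: "E t'' x = E t x" if "x \<in> X" for x
    using side_cases[OF t''D] side_cases[OF Du(1)] that x0 by metis
  have ne: "t \<noteq> t''" using T_unique t t'' by metis
  have H: "E t'' y = E t' y" if "y \<in> H" for y using dup_adj[OF t''(2) that] .
  have nE: "\<not> E t t''" using t(4) H[OF Du(3)] sym_iff by blast
  have "card X \<le> card {x \<in> V. E t x \<noteq> E t'' x}"
    unfolding X_def using tau_min[OF _ _ ne nE] Du t'' HV by auto
  also have "\<dots> \<le> card (D \<union> (W \<union> partner ` W))"
  proof (rule card_mono)
    show "finite (D \<union> (W \<union> partner ` W))" using XV finT by (auto simp: W_def)
    show "{x \<in> V. E t x \<noteq> E t'' x} \<subseteq> D \<union> (W \<union> partner ` W)"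
    proof
      fix y assume "y \<in> {x \<in> V. E t x \<noteq> E t'' x}"
      then have y: "y \<in> V" "E t y \<noteq> E t'' y" by auto
      then have yH: "y \<in> H" using X XV by auto
      have yI: "y \<notin> Is"
        using y Du t'' sym by (auto simp: Is_def nbh_def)
      show "y \<in> D \<union> (W \<union> partner ` W)"
      proof (cases "y \<in> Du")
        case True
        then obtain s where s: "s \<in> T" "nbh E H s = nbh E H y" "y = s \<or> y = partner s" by (rule Du_cases)
        have "E t s = E t y" "E t' s = E t' y"
          using dup_adj[OF s(2), of t] dup_adj[OF s(2), of t'] Du sym_iff by blast+
        then have "s \<in> W" using y H[OF yH] s by (auto simp: W_def)
        then show ?thesis using s by auto
      qed (use yH yI in \<open>auto simp: D_def\<close>)
    qed
  qed
  also have "\<dots> \<le> card D + (card W + card (partner ` W))"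
    using card_Un_le[of D "W \<union> partner ` W"] card_Un_le[of W "partner ` W"] by linarith
  also have "\<dots> \<le> card D + (card W + card W)"
    using finT by (intro add_left_mono card_image_le) (auto simp: W_def)
  finally show ?thesis by (simp add: W_def)
qed

lemma no_dup_T:
  assumes "t \<in> T" "t' \<in> T" "nbh E T t = nbh E T t'"
  shows "t = t'"
proof (rule ccontr)
  assume ne: "t \<noteq> t'"
  have empty: "{y \<in> T. E t y \<noteq> E t' y} = {}" using assms(3) by (auto simp: nbh_def)
  have "\<not> E t t'" using assms irr by (auto simp: nbh_def)
  from T_dist[OF assms(1,2) ne this] have "card X \<le> card D" unfolding empty by simp
  then show False using count_D card_Is by linarith
qed

text \<open>Vertices on the same side of \<open>X\<close> have the same neighbours in
  \<open>Du\<close> and \<open>Is\<close>, so such duplicates would differ only on \<open>D\<close>,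
  which has fewer than \<open>card X\<close> vertices.\<close>

lemma no_dup_X:
  assumes "x \<in> X" "x' \<in> X" "E a x = E a x'" "nbh E X x = nbh E X x'"
  shows "x = x'"
proof (rule ccontr)
  assume ne: "x \<noteq> x'"
  have XX: "E x y = E x' y" if "y \<in> X" for y using assms(4) that by (auto simp: nbh_def)
  have nE: "\<not> E x x'" using XX[OF assms(2)] irr by auto
  have "card X \<le> card {y \<in> V. E x y \<noteq> E x' y}"
    unfolding X_def using tau_min[OF _ _ ne nE] assms XV by auto
  also have "\<dots> \<le> card D"
  proof (rule card_mono[OF XV(8)], rule subsetI)
    fix y assume "y \<in> {y \<in> V. E x y \<noteq> E x' y}"
    then have y: "y \<in> V" "E x y \<noteq> E x' y" by auto
    then have yH: "y \<in> H" using XX XV by auto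
    have "y \<notin> Is" using isolated_nbh(1)[of y] assms y sym_iff by blast
    moreover have "y \<notin> Du" using side_cases[of y] assms y sym_iff by metis
    ultimately show "y \<in> D" using yH by (auto simp: D_def)
  qed
  finally show False using count_D card_Is by linarith
qed

text \<open>The graph on \<open>T\<close> may have one isolated vertex, though by
  \<open>no_dup_T\<close> not two; without it the graph is reduced.\<close>

definition "Tn = {t \<in> T. nbh E T t \<noteq> {}}"

lemma reduced_Tn: "reduced_on E Tn"
proof (rule reduced_on_representatives[of E _ T, OF sym])
  show "inj_on (nbh E T) Tn" using no_dup_T by (auto simp: Tn_def inj_on_def)
qed (auto simp: Tn_def)

lemma card_Tn: "card Tn + 2 \<le> mu (rk T)"
proof -
  have "Tn \<subseteq> T" by (auto simp: Tn_def)
  then have "Tn \<subset> V" using TH by (intro sub_H_psubset) blast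
  then have "card Tn + 2 \<le> mu (rk Tn)" using reduced_Tn by (intro card_reduced)
  also have "\<dots> \<le> mu (rk T)" using \<open>Tn \<subseteq> T\<close> TH HV by (intro mu_mono rk_mono) auto
  finally show ?thesis .
qed

lemma card_T_Tn: "card T \<le> card Tn + 1"
proof -
  have "card (T - Tn) \<le> 1"
    using finT by (intro card_le_Suc0_iff_eq[THEN iffD2, THEN order_trans]) (auto simp: Tn_def intro: no_dup_T)
  then show ?thesis using card_Diff_subset[of Tn T] finT finite_subset[of Tn T] by (auto simp: Tn_def)
qed

text \<open>On \<open>Xh\<close> the form is the adjacency matrix of \<open>X\<close> bordered by the vector with entries \<open>1\<close> or \<open>-1\<close>
  that tells which of \<open>a\<close> and \<open>b\<close> is the neighbour.\<close>

definition "Xh = adjoin (supported X) (dv a b)"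

lemma aVb: "a \<in> V" "b \<in> V" "a \<notin> X" "b \<notin> X" using ab HV XV by auto

lemma Xh: "lin_closed Xh" "supported X \<subseteq> Xh" "Xh \<subseteq> supported V" "dv a b \<in> Xh"
  unfolding Xh_def
  using adjoin_subset adjoin_mem[OF lin_closed_supported] lin_closed_adjoin[OF lin_closed_supported]
    adjoin_least[OF lin_closed_supported supported_mono[OF XV(1)] dv_supported[OF aVb(1,2)]]
  by auto

section \<open>Adding the rank of \<open>T\<close> to that of the bordered form\<close>

definition side :: "'a \<Rightarrow> real" where "side t = (if \<forall>x\<in>X. E t x = E a x then 1 / 2 else - 1 / 2)"

text \<open>A correction by a kernel vector of \<open>H\<close>: it does not change the form on
  \<open>T\<close>, but makes the pairing with \<open>X\<close> depend only on the sum of the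
  entries of \<open>h\<close>.\<close>

definition lift :: "('a \<Rightarrow> real) \<Rightarrow> 'a \<Rightarrow> real" where
  "lift h = (\<lambda>x. h x + (- (\<Sum>t\<in>T. h t * side t)) * dv a b x)"

lemma B_dv_dv: "B (dv a b) (dv a b) = 0"
  using ab by (intro dv_kernel dv_supported) auto

lemma B_dv_T: "h \<in> supported T \<Longrightarrow> B (dv a b) h = 0"
  using ab supported_mono[OF TH] by (intro dv_kernel) auto

lemma B_dv_lift: "h \<in> supported T \<Longrightarrow> B (dv a b) (lift h) = 0"
  unfolding lift_def adj_form_right by (simp add: B_dv_T B_dv_dv)

lemma B_lift_lift: "h \<in> supported T \<Longrightarrow> h' \<in> supported T \<Longrightarrow> B (lift h) (lift h') = B h h'"
  unfolding lift_def adj_form_right adj_form_left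
  by (simp add: B_dv_T B_dv_dv B_swap[of h "dv a b"])

lemma lift_supported: "h \<in> supported T \<Longrightarrow> lift h \<in> supported V"
  unfolding lift_def using supported_mono[OF TV]
  by (intro lin_closedD[OF lin_closed_supported] dv_supported[OF aVb(1,2)]) auto

text \<open>Subtracting half of the row of \<open>dv a b\<close>, with the appropriate sign, from the row of a vertex of
  \<open>T\<close> makes it constant on \<open>X\<close>.\<close>

lemma B_unit_lift:
  assumes x: "x \<in> X" and h: "h \<in> supported T"
  shows "B (unit_fun x) (lift h) = (\<Sum>t\<in>T. h t) / 2"
proof -
  have xV: "x \<in> V" using x XV by blast
  define \<sigma> where "\<sigma> = B (dv a b) (unit_fun x)"
  have \<sigma>: "\<sigma> = (if E a x then 1 else - 1)"
    using B_dv[OF aVb(1,2) xV] dup_X[OF ab x] by (auto simp: \<sigma>_def)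
  have t: "B (unit_fun x) (unit_fun t) = 1 / 2 + side t * \<sigma>" if "t \<in> T" for t
  proof -
    have "(\<forall>x\<in>X. E t x = E a x) \<or> (\<forall>x\<in>X. E t x \<noteq> E a x)" using side_cases that TDu by blast
    then show ?thesis
      using that TV xV x by (auto simp: B_units \<sigma> side_def sym_iff[of x t])
  qed
  have "B (unit_fun x) h = (\<Sum>t\<in>T. h t * B (unit_fun x) (unit_fun t))" by (rule B_expand[OF TV h])
  also have "\<dots> = (\<Sum>t\<in>T. h t / 2 + \<sigma> * (h t * side t))"
    by (intro sum.cong refl) (simp add: t algebra_simps)
  also have "\<dots> = (\<Sum>t\<in>T. h t) / 2 + \<sigma> * (\<Sum>t\<in>T. h t * side t)"
    by (simp add: sum.distrib sum_divide_distrib sum_distrib_left)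
  finally show ?thesis
    unfolding lift_def adj_form_right B_swap[of "unit_fun x" "dv a b"] \<sigma>_def[symmetric] by simp
qed

text \<open>The pairing is a product of two linear functionals, so it has rank at most one; this is
  the source of the \<open>+ 1\<close> in \<open>rk_T_Xh\<close>.\<close>

lemma B_Xh_lift:
  assumes "u \<in> Xh" "h \<in> supported T"
  shows "B u (lift h) = (\<Sum>x\<in>X. u x) * (\<Sum>t\<in>T. h t) / 2"
proof -
  obtain g c where u: "g \<in> supported X" "u = (\<lambda>x. g x + c * dv a b x)"
    using assms by (auto simp: Xh_def adjoin_def)
  have "B u (lift h) = B g (lift h)" using B_dv_lift[OF assms(2)] by (simp add: u adj_form_left)
  also have "\<dots> = (\<Sum>x\<in>X. g x * B (unit_fun x) (lift h))"
    using B_expand[OF XV(1) u(1), of "lift h"] by (simp add: B_swap)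
  also have "\<dots> = (\<Sum>x\<in>X. g x * ((\<Sum>t\<in>T. h t) / 2))"
    by (intro sum.cong refl) (simp only: B_unit_lift[OF _ assms(2)])
  also have "\<dots> = (\<Sum>x\<in>X. g x) * (\<Sum>t\<in>T. h t) / 2"
    unfolding sum_distrib_right[symmetric] by simp
  also have "(\<Sum>x\<in>X. g x) = (\<Sum>x\<in>X. u x)"
    using aVb by (intro sum.cong refl) (auto simp: u dv_def unit_fun_def)
  finally show ?thesis .
qed

lemma dual_systems_lift: "dual_systems B (lift ` supported T) (lift ` supported T) (rk T)"
proof -
  have "supported T \<subseteq> supported V" using TH HV by (intro supported_mono) blast
  from dual_systems_form_rank[OF finV this, of E]
  obtain p q where pq: "\<And>i. i < rk T \<Longrightarrow> p i \<in> supported T" "\<And>i. i < rk T \<Longrightarrow> q i \<in> supported T"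
    "\<And>i j. i < rk T \<Longrightarrow> j < rk T \<Longrightarrow> B (p i) (q j) = of_bool (i = j)"
    unfolding dual_systems_def by blast
  show ?thesis
    by (rule dual_systemsI[of _ "\<lambda>i. lift (p i)" _ "\<lambda>i. lift (q i)"]) (use pq in \<open>auto simp: B_lift_lift\<close>)
qed

text \<open>On the hyperplane of \<open>Xh\<close> where the entries on \<open>X\<close> sum to
  zero, the pairing with all lifted vectors vanishes. Restricting one side to it costs one rank and
  makes the Gram matrix block triangular.\<close>

lemma rk_T_Xh: "rk T + form_rank E V Xh \<le> r + 1"
proof (cases "form_rank E V Xh")
  case 0
  then show ?thesis using rk_mono[OF TV order_refl] rankV by linarith
next
  case (Suc k)
  have "dual_systems B Xh Xh (Suc k)" using dual_systems_form_rank[OF finV Xh(3), of E] Suc by simp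
  then have 1: "dual_systems B {u \<in> Xh. (\<Sum>x\<in>X. u x) = 0} Xh k"
    by (rule dual_systems_hyperplane[OF _ Xh(1), where \<phi> = "\<lambda>u. \<Sum>x\<in>X. u x"])
      (simp add: sum.distrib sum_distrib_left)
  have "dual_systems B (supported V) (supported V) (k + rk T)"
    by (rule dual_systems_block[OF 1 dual_systems_lift _ _ _ _ _ lin_closed_supported])
      (use Xh(3) in \<open>auto simp: B_Xh_lift lift_supported\<close>)
  then have "k + rk T \<le> r" using le_form_rank_iff[OF finV order_refl, of _ E] rankV by simp
  then show ?thesis using Suc by simp
qed

text \<open>An isolated vertex \<open>t\<close> of the graph on \<open>T\<close> can absorb the sum
  of the entries without changing the form on \<open>T\<close>. The pairing with \<open>Xh\<close>
  then vanishes without passing to a hyperplane.\<close>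

lemma rk_T_Xh_isolated:
  assumes "T \<noteq> Tn"
  shows "rk T + form_rank E V Xh \<le> r"
proof -
  obtain t where t: "t \<in> T" "nbh E T t = {}" using assms by (auto simp: Tn_def)
  define h' where "h' h = (\<lambda>x. h x + (- (\<Sum>s\<in>T. h s)) * unit_fun t x)" for h :: "'a \<Rightarrow> real"
  have h'T: "h' h \<in> supported T" if "h \<in> supported T" for h
    unfolding h'_def using that t by (intro lin_closedD lin_closed_supported unit_fun_supported) auto
  have h'0: "(\<Sum>s\<in>T. h' h s) = 0" for h
  proof -
    have "(\<Sum>s\<in>T. unit_fun t s) = (1::real)" using t finT by (simp add: unit_fun_def of_bool_def)
    then show ?thesis unfolding h'_def sum.distrib sum_distrib_left[symmetric] by simp
  qed
  have "B g (unit_fun t) = 0" if "g \<in> supported T" for g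
    unfolding B_swap[of g] by (rule B_zeroI[OF TV that]) (use t TV in \<open>auto simp: B_units nbh_def subset_eq\<close>)
  then have B': "B g (h' h) = B g h" if "g \<in> supported T" for g h
    using that unfolding h'_def adj_form_right by simp
  define W where "W = (\<lambda>h. lift (h' h)) ` supported T"
  have "supported T \<subseteq> supported V" using TV by (rule supported_mono)
  from dual_systems_form_rank[OF finV this, of E]
  obtain p q where pq: "\<And>i. i < rk T \<Longrightarrow> p i \<in> supported T" "\<And>i. i < rk T \<Longrightarrow> q i \<in> supported T"
    "\<And>i j. i < rk T \<Longrightarrow> j < rk T \<Longrightarrow> B (p i) (q j) = of_bool (i = j)"
    unfolding dual_systems_def by blast
  have 2: "dual_systems B (lift ` supported T) W (rk T)"
    by (rule dual_systemsI[of _ "\<lambda>i. lift (p i)" _ "\<lambda>i. lift (h' (q i))"])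
      (use pq in \<open>auto simp: B_lift_lift h'T B' W_def\<close>)
  have "dual_systems B (supported V) (supported V) (form_rank E V Xh + rk T)"
    by (rule dual_systems_block[OF dual_systems_form_rank[OF finV Xh(3)] 2 _ _ _ _ _ lin_closed_supported])
      (use Xh(3) in \<open>auto simp: B_Xh_lift lift_supported h'T h'0 W_def\<close>)
  then show ?thesis using le_form_rank_iff[OF finV order_refl, of _ E] rankV by (simp add: add.commute)
qed


section \<open>The order of \<open>X\<close> and the rank of the bordered form\<close>

lemma B_unit_dv: "x \<in> X \<Longrightarrow> B (unit_fun x) (dv a b) = (if E a x then 1 else - 1)"
  using B_dv[OF aVb(1,2), of x] dup_X[OF ab, of x] XV by (subst B_swap) auto

lemma X_psubset: "X \<subset> V" using XV aVb by blast

lemma Xh_kernel: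
  assumes "z \<in> supported X" "\<And>y. y \<in> X \<Longrightarrow> B z (unit_fun y) = 0" "B z (dv a b) \<noteq> 0"
  shows "rk X + 2 \<le> form_rank E V Xh"
proof (rule kernel_rank[OF lin_closed_supported Xh(1,3,2) assms(1) _ Xh(4) assms(3)])
  show "B z w = 0" if "w \<in> supported X" for w
    by (rule B_zeroI[OF XV(1) that assms(2)])
qed

text \<open>An isolated vertex or a duplicated pair gives a kernel vector of \<open>X\<close>. By
  \<open>no_dup_X\<close> such a pair lies on different sides, so the border does not annihilate
  this vector.\<close>

lemma Xh_not_reduced:
  assumes "\<not> reduced_on E X"
  shows "rk X + 2 \<le> form_rank E V Xh"
proof -
  consider x where "x \<in> X" "nbh E X x = {}" | x x' where "x \<in> X" "x' \<in> X" "x \<noteq> x'" "nbh E X x = nbh E X x'"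
    using assms by (auto simp: reduced_on_def inj_on_def)
  then show ?thesis
  proof cases
    case (1 x)
    show ?thesis
      by (rule Xh_kernel[of "unit_fun x"])
        (use 1 XV(1) in \<open>auto simp: B_unit_dv unit_fun_supported B_units nbh_def subset_eq\<close>)
  next
    case (2 x x')
    have ne: "E a x \<noteq> E a x'" using no_dup_X 2 by blast
    have eq: "E x y = E x' y" if "y \<in> X" for y using 2(4) that by (auto simp: nbh_def)
    show ?thesis
    proof (rule Xh_kernel[of "dv x x'"])
      show "dv x x' \<in> supported X" by (rule dv_supported[OF 2(1,2)])
      show "B (dv x x') (unit_fun y) = 0" if "y \<in> X" for y
        using eq[OF that] 2 that XV(1) by (subst B_dv) auto
      show "B (dv x x') (dv a b) \<noteq> 0"
        unfolding dv_def[of x x'] adj_form_minus using B_unit_dv[OF 2(1)] B_unit_dv[OF 2(2)] ne by auto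
    qed
  qed
qed

text \<open>Every side of \<open>X\<close> contains at most one vertex of each duplication class.\<close>

lemma card_X_classes:
  obtains c where "card X \<le> 2 * c + 2" "c + 2 \<le> mu (rk X)"
proof -
  define Xn where "Xn = {x \<in> X. nbh E X x \<noteq> {}}"
  obtain R where R: "R \<subseteq> Xn" "inj_on (nbh E X) R" "nbh E X ` Xn = nbh E X ` R"
    using iffD1[OF subset_image_inj order_refl[of "nbh E X ` Xn"]] by auto
  have RX: "R \<subseteq> X" using R(1) by (auto simp: Xn_def)
  then have finR: "finite R" using XV(4) by (rule finite_subset)
  have "reduced_on E R"
  proof (rule reduced_on_representatives[of E _ X, OF sym RX _ R(2)])
    show "nbh E X v \<noteq> {}" if "v \<in> R" for v using that R by (auto simp: Xn_def)
    show "\<exists>t\<in>R. nbh E X t = nbh E X v" if "v \<in> X" "nbh E X v \<noteq> {}" for v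
    proof -
      have "nbh E X v \<in> nbh E X ` R" using that unfolding R(3)[symmetric] by (auto simp: Xn_def)
      then show ?thesis by auto
    qed
  qed
  then have "card R + 2 \<le> mu (rk R)" using RX X_psubset by (intro card_reduced) auto
  also have "\<dots> \<le> mu (rk X)" using RX XV by (intro mu_mono rk_mono) auto
  finally have 1: "card R + 2 \<le> mu (rk X)" .
  have side: "card {x \<in> X. E a x = s} \<le> card R + 1" for s
  proof -
    have "inj_on (nbh E X) {x \<in> X. E a x = s}" using no_dup_X by (auto simp: inj_on_def)
    then have "card {x \<in> X. E a x = s} = card (nbh E X ` {x \<in> X. E a x = s})" by (simp add: card_image)
    \<comment> \<open>The empty set accounts for a vertex isolated in \<open>X\<close>, possibly one
      on each side, whence the constant 2 in the bound on \<open>card X\<close>.\<close>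
    also have "\<dots> \<le> card (insert {} (nbh E X ` R))"
      unfolding R(3)[symmetric] using XV(4) by (intro card_mono) (auto simp: Xn_def)
    also have "\<dots> \<le> card (nbh E X ` R) + 1" using finR by (simp add: card_insert_if)
    also have "\<dots> = card R + 1" using R(2) by (simp add: card_image)
    finally show ?thesis .
  qed
  have "card X = card ({x \<in> X. E a x = True} \<union> {x \<in> X. E a x = False})" by (rule arg_cong[of _ _ card]) auto
  also have "\<dots> \<le> (card R + 1) + (card R + 1)"
    by (rule order_trans[OF card_Un_le add_mono[OF side side]])
  finally show thesis using that[of "card R"] 1 by simp
qed

text \<open>Here \<open>X\<close> is a triangle, whose adjacency matrix is invertible. Bordering it
  by a vector of signs gives a nonzero Schur complement and so one more rank.\<close>

lemma triangle_rank:
  assumes "card X = 3" "reduced_on E X"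
  shows "4 \<le> form_rank E V Xh"
proof -
  obtain x y z where X: "X = {x, y, z}" "x \<noteq> y" "x \<noteq> z" "y \<noteq> z"
    using assms(1) by (metis card_3_iff)
  have E: "E u v = (u \<noteq> v)" if "u \<in> X" "v \<in> X" for u v
    using reduced_on_3_clique[OF assms sym irr that] irr by blast
  \<comment> \<open>The rows of the inverse: all entries 1/2, minus the identity.\<close>
  define Q where "Q u = (\<lambda>v. if v \<in> X then if v = u then - 1 / 2 else 1 / 2 else (0::real))" for u
  define s where "s v = (if E a v then 1 else - 1 :: real)" for v
  have QX: "Q u \<in> supported X" for u by (simp add: Q_def supported_def)
  have Qe: "B (Q u) g = (\<Sum>v\<in>X. Q u v * B (unit_fun v) g)" for u g
    using B_expand[OF XV(1) QX, of g u] by (simp add: B_swap)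
  have QB: "B (Q u) (unit_fun w) = of_bool (u = w)" if "u \<in> X" "w \<in> X" for u w
  proof -
    have "B (Q u) (unit_fun w) = (\<Sum>v\<in>X. Q u v * of_bool (v \<noteq> w))"
      unfolding Qe using that XV(1) E by (intro sum.cong refl) (auto simp: B_units subset_eq)
    also have "\<dots> = of_bool (u = w)" using that X by (auto simp: Q_def)
    finally show ?thesis .
  qed
  have d: "dual_systems B (supported X) (supported X) 3"
  proof (rule dual_systemsI[of _ "\<lambda>i. Q ([x, y, z] ! i)" _ "\<lambda>i. unit_fun ([x, y, z] ! i)"])
    have nth: "[x, y, z] ! i \<in> X" if "i < 3" for i
      using nth_mem[of i "[x, y, z]"] that X by auto
    then show "unit_fun ([x, y, z] ! i) \<in> supported X" if "i < 3" for i
      using that by (intro unit_fun_supported)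
    fix i j :: nat assume ij: "i < 3" "j < 3"
    have "[x, y, z] ! i = [x, y, z] ! j \<longleftrightarrow> i = j"
      using X ij by (intro nth_eq_iff_index_eq) auto
    then show "B (Q ([x, y, z] ! i)) (unit_fun ([x, y, z] ! j)) = of_bool (i = j)"
      using QB[OF nth nth] ij by simp
  qed (rule QX)
  define S where "S = (\<lambda>v. \<Sum>u\<in>X. s u * Q u v)"
  have SX: "S \<in> supported X" unfolding S_def by (intro lin_closed_sum lin_closed_supported QX)
  define z0 where "z0 = (\<lambda>v. dv a b v + (- 1) * S v)"
  have z0: "z0 \<in> Xh" unfolding z0_def using SX Xh by (intro lin_closedD) auto
  have "B z0 (unit_fun w) = 0" if w: "w \<in> X" for w
  proof -
    have "B S (unit_fun w) = (\<Sum>u\<in>X. s u * of_bool (u = w))"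
      unfolding S_def adj_form_sum_left using QB w by (intro sum.cong) auto
    also have "\<dots> = s w" using w X by auto
    finally show ?thesis
      using B_unit_dv[OF w] unfolding z0_def adj_form_left B_swap[of "unit_fun w"] by (simp add: s_def)
  qed
  then have ker: "B z0 w = 0" if "w \<in> supported X" for w
    using B_zeroI[OF XV(1) that] by blast
  have "B S (dv a b) = (\<Sum>u\<in>X. s u * (\<Sum>v\<in>X. Q u v * s v))"
    unfolding S_def adj_form_sum_left Qe by (intro sum.cong refl arg_cong2[of _ _ _ _ times]) (simp add: B_unit_dv s_def)
  \<comment> \<open>With \<open>\<sigma>\<close> the sum of the three signs, the value is
    \<open>\<sigma>^2 / 2 - 3\<close>, that is, 3/2 or -5/2.\<close>
  also have "\<dots> \<noteq> 0" using X by (auto simp: Q_def s_def)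
  finally have "B z0 (dv a b) \<noteq> 0" unfolding z0_def adj_form_left by (simp add: B_dv_dv)
  from d ker this have "dual_systems B Xh Xh (Suc 3)"
    by (rule dual_systems_border) (use z0 Xh in auto)
  then show ?thesis using le_form_rank_iff[OF finV Xh(3), of 4 E] by (simp add: numeral_eq_Suc)
qed

text \<open>If \<open>X\<close> is not reduced, its order can nearly double, but the border then
  adds two ranks, which at least doubles \<open>mu\<close>.\<close>

lemma card_X_bound: "card X + 2 \<le> mu (form_rank E V Xh)"
proof (cases "reduced_on E X")
  case True
  then have "card X + 2 \<le> mu (rk X)" using X_psubset by (rule card_reduced[rotated])
  also have "\<dots> \<le> mu (form_rank E V Xh)" by (intro mu_mono form_rank_mono finV Xh)
  finally show ?thesis .
next
  case False
  obtain c where "card X \<le> 2 * c + 2" "c + 2 \<le> mu (rk X)" by (rule card_X_classes)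
  then have "card X + 2 \<le> 2 * mu (rk X)" by linarith
  also have "\<dots> \<le> mu (rk X + 2)" by (rule mu_double_le)
  also have "\<dots> \<le> mu (form_rank E V Xh)" by (intro mu_mono Xh_not_reduced False)
  finally show ?thesis .
qed

text \<open>As \<open>mu 3 = 5\<close>, \<open>card_X_bound\<close> would still permit three
  vertices; \<open>triangle_rank\<close> excludes them.\<close>

lemma card_X_le_2:
  assumes "form_rank E V Xh \<le> 3"
  shows "card X \<le> 2"
proof (cases "reduced_on E X")
  case True
  have "card X + 2 \<le> mu 3" using card_X_bound mu_mono[OF assms] by linarith
  moreover have "card X \<noteq> 3" using triangle_rank True assms by auto
  ultimately show ?thesis by (simp add: mu_small)
next
  case False
  then have "rk X = 0 \<or> rk X = 1" using Xh_not_reduced assms by linarith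
  then have "mu (rk X) = 2" by (auto simp: mu_small)
  moreover obtain c where "card X \<le> 2 * c + 2" "c + 2 \<le> mu (rk X)" by (rule card_X_classes)
  ultimately show ?thesis by simp
qed

section \<open>The possible sets of representatives\<close>

lemma Tn_sub: "Tn \<subseteq> T" by (auto simp: Tn_def)

lemma Tn_edge:
  assumes "t \<in> Tn"
  shows "\<exists>u\<in>Tn. u \<noteq> t \<and> E t u"
proof -
  obtain u where "u \<in> Tn" "E t u" using reduced_Tn assms by (auto simp: reduced_on_def nbh_def)
  moreover have "u \<noteq> t" using \<open>E t u\<close> irr by auto
  ultimately show ?thesis by blast
qed

lemma card_Tn_ne_1: "card Tn \<noteq> 1"
  using Tn_edge by (metis card_1_singletonE singletonD singletonI)

lemma card_T_pos: "1 \<le> card T"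
  using finT T_nonempty by (simp add: Suc_leI card_gt_0_iff)

lemma final_cases:
  assumes "Is = {}"
  shows "(card T = 1 \<and> mu (r - 2) \<le> card X) \<or>
    ((\<forall>t\<in>T. \<forall>u\<in>T. t \<noteq> u \<longrightarrow> E t u) \<and>
      (card T = 2 \<and> mu (r - 2) \<le> card X + 1 \<or> card T = 3 \<and> card X + 2 = mu (r - 2)))"
proof -
  have count: "mu (r - 2) + 1 \<le> card X + card T" using count_X assms by simp
  have TTn: "T = Tn \<and> card T = card Tn \<or> T \<noteq> Tn \<and> card T = card Tn + 1"
  proof (cases "T = Tn")
    case False
    then have "card Tn < card T" using Tn_sub by (intro psubset_card_mono[OF finT]) blast
    then show ?thesis using False card_T_Tn by linarith
  qed simp
  consider "card Tn = 0" | "card Tn = 2" | "card Tn = 3" | "4 \<le> card Tn"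
    using card_Tn_ne_1 by linarith
  then show ?thesis
  proof cases
    case 1
    then have "card T = 1" using card_T_Tn card_T_pos by linarith
    then show ?thesis using count by simp
  next
    case 2
    then obtain u v where uv: "Tn = {u, v}" "u \<noteq> v" by (auto simp: card_2_iff)
    then have Euv: "E u v" "E v u" using Tn_edge[of u] sym by auto
    show ?thesis
    proof (cases "T = Tn")
      case True
      then show ?thesis using uv Euv count 2 by auto
    next
      case False
      then obtain t where t: "t \<in> T" "nbh E T t = {}" by (auto simp: Tn_def)
      then have "T = {u, v, t}"
        using TTn False 2 uv finT Tn_sub by (intro card_seteq[symmetric]) (auto simp: Tn_def card_insert_if)
      have uT: "u \<in> T" "t \<noteq> u" using uv Tn_sub t by (auto simp: Tn_def)
      have nt: "\<not> E t y" "\<not> E y t" if "y \<in> T" for y using t that sym by (auto simp: nbh_def)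
      \<comment> \<open>The isolated \<open>t\<close> and an end of the only edge differ in
        \<open>T\<close> at the other end alone, so \<open>T_dist\<close> contradicts
        \<open>count_D\<close>.\<close>
      have "{y \<in> T. E t y \<noteq> E u y} \<subseteq> {v}"
        using nt irr \<open>T = {u, v, t}\<close> by auto
      then have "card {y \<in> T. E t y \<noteq> E u y} \<le> 1" using card_mono[of "{v}"] by fastforce
      then have "card X \<le> card D + 2" using T_dist[OF t(1) uT(1,2) nt(1)[OF uT(1)]] by linarith
      then show ?thesis using count_D assms by simp
    qed
  next
    case 3
    have clique: "E t u" if "t \<in> Tn" "u \<in> Tn" "t \<noteq> u" for t u
      using reduced_on_3_clique[OF 3 reduced_Tn sym irr that] .
    have "3 \<le> rk T"
    proof (rule ccontr)
      assume "\<not> ?thesis"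
      then have "mu (rk T) \<le> mu 2" by (intro mu_mono) simp
      then show False using card_Tn 3 by (simp add: mu_small)
    qed
    show ?thesis
    proof (cases "T = Tn")
      case True
      have "form_rank E V Xh \<le> r - 2" using rk_T_Xh \<open>3 \<le> rk T\<close> by linarith
      \<comment> \<open>This meets the lower bound \<open>count\<close>, which gives the equality
        for three representatives.\<close>
      then have "card X + 2 \<le> mu (r - 2)" using card_X_bound mu_mono by (meson order_trans)
      then show ?thesis using True clique count 3 by auto
    next
      case False
      have "form_rank E V Xh \<le> r - 3" using rk_T_Xh_isolated[OF False] \<open>3 \<le> rk T\<close> by linarith
      then have "card X + 2 \<le> mu (r - 3)" using card_X_bound mu_mono by (meson order_trans)
      \<comment> \<open>Since \<open>mu 4 = 8\<close>, this is the gap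
        \<open>mu (r - 3) + 4 < mu (r - 2)\<close>.\<close>
      moreover have "mu 4 + mu (r - 3) < mu (4 + (r - 3) - 3) + 4" using r10 by (intro mu_add_less) auto
      moreover have "4 + (r - 3) - 3 = r - 2" using r10 by simp
      ultimately show ?thesis using count TTn False 3 by (simp add: mu_small)
    qed
  next
    case 4
    have q: "4 \<le> rk T"
    proof (rule ccontr)
      assume "\<not> ?thesis"
      then have "mu (rk T) \<le> mu 3" by (intro mu_mono) simp
      then show False using card_Tn 4 by (simp add: mu_small)
    qed
    have "3 \<le> card X" using count card_D_T by linarith
    then have "4 \<le> form_rank E V Xh" using card_X_le_2 by fastforce
    \<comment> \<open>The largest bordered rank that \<open>rk_T_Xh\<close> allows.\<close>
    define y where "y = r + 1 - rk T"
    have y: "form_rank E V Xh \<le> y" "4 \<le> y" "rk T + y = r + 1"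
      using rk_T_Xh \<open>4 \<le> form_rank E V Xh\<close> by (auto simp: y_def)
    have "card X + 2 \<le> mu y" using card_X_bound mu_mono[OF y(1)] by linarith
    moreover have "mu (rk T) + mu y < mu (rk T + y - 3) + 4" using q y r10 by (intro mu_add_less) auto
    moreover have "rk T + y - 3 = r - 2" using y by simp
    ultimately show ?thesis using count card_Tn card_T_Tn by simp
  qed
qed

end

section \<open>Exclusion of isolated vertices of \<open>H\<close>\<close>

context dup_subgraph
begin

lemma Is_empty: "Is = {}"
proof (rule ccontr)
  assume "Is \<noteq> {}"
  then obtain w where w: "w \<in> Is" by blast
  have wH: "w \<in> H" "w \<in> V" "w \<notin> X" "\<And>y. y \<in> H \<Longrightarrow> \<not> E w y" using w XV by (auto simp: Is_def nbh_def)
  obtain x0 where x0: "x0 \<in> X" using X_nonempty by blast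
  \<comment> \<open>With an isolated vertex present, every duplicated vertex is joined to all or to
    none of \<open>X\<close>; the vertices of the second kind represent the pairs.\<close>
  define T where "T = {v \<in> Du. \<forall>x\<in>X. \<not> E v x}"
  interpret dup_reps V E r H a b T
  proof
    show "T \<subseteq> Du" by (auto simp: T_def)
    fix v assume v: "v \<in> Du"
    then obtain u where u: "v \<in> H" "u \<in> H" "u \<noteq> v" "nbh E H u = nbh E H v" by (auto simp: Du_def)
    have uDu: "u \<in> Du" using u unfolding Du_def by (intro CollectI conjI bexI[of _ v]) auto
    have const: "E u x = E u x0" "E v x = E v x0" if "x \<in> X" for x
      using dup_sides[OF u(2,1,3,4) that x0] dup_sides[OF u(1,2) u(3)[symmetric] u(4)[symmetric] that x0]
        isolated_nbh(2)[OF w that x0] by auto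
    have "E u x0 \<noteq> E v x0" by (rule dup_X[OF u(2,1,3,4) x0])
    then have "u \<in> T \<or> v \<in> T" using const uDu v by (auto simp: T_def)
    then have ex: "\<exists>t. t \<in> T \<and> nbh E H t = nbh E H v" using u by auto
    have "t = t'" if "t \<in> T \<and> nbh E H t = nbh E H v" "t' \<in> T \<and> nbh E H t' = nbh E H v" for t t'
    proof (rule ccontr)
      assume ne: "t \<noteq> t'"
      have "t \<in> H" "t' \<in> H" "nbh E H t = nbh E H t'" using that by (auto simp: T_def Du_def)
      from dup_X[OF this(1,2) ne this(3) x0] show False using that x0 by (auto simp: T_def)
    qed
    then show "\<exists>!t. t \<in> T \<and> nbh E H t = nbh E H v" using ex by blast
  qed
  have TX: "\<not> E t x" "\<not> E x t" if "t \<in> T" "x \<in> insert w X" for t x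
    using that wH(4) TH sym by (auto simp: T_def)
  have card: "card (insert w X) = card X + 1" using XV(4) wH(3) by simp
  have "a \<in> Du" using ab by (auto simp: Du_def)
  then have "a \<noteq> w" using Is_Du w by blast
  then have wX: "insert w X \<subset> V" using XV(1) wH(2) aVb by blast
  have "reduced_on E (insert w X)"
    unfolding reduced_on_def
  proof
    show "\<forall>v\<in>insert w X. nbh E (insert w X) v \<noteq> {}"
      using isolated_nbh(1)[OF w] x0 sym by (auto simp: nbh_def)
    show "inj_on (nbh E (insert w X)) (insert w X)"
    proof (rule inj_onI)
      fix x x' assume x: "x \<in> insert w X" "x' \<in> insert w X" "nbh E (insert w X) x = nbh E (insert w X) x'"
      have adj: "E x y = E x' y" if "y \<in> insert w X" for y using x(3) that by (auto simp: nbh_def)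
      have "x \<in> X \<longleftrightarrow> x' \<in> X" using adj[OF x(1)] adj[OF x(2)] x isolated_nbh(1)[OF w] irr wH(3) by auto
      moreover have "x = x'" if "x \<in> X" "x' \<in> X"
        by (rule no_dup_X[OF that isolated_nbh(2)[OF w that]]) (use adj in \<open>auto simp: nbh_def\<close>)
      ultimately show "x = x'" using x by auto
    qed
  qed
  then have cx: "card X + 3 \<le> mu (rk (insert w X))" using card_reduced[OF wX] card by simp
  define Z where "Z = insert w X \<union> T"
  have Z: "Z \<subseteq> V" "insert w X \<subseteq> Z" "T \<subseteq> Z" using wX TV by (auto simp: Z_def)
  note supp = supported_mono[OF Z(1)] supported_mono[OF Z(2)] supported_mono[OF Z(3)]
  have "dual_systems B (supported Z) (supported Z) (rk (insert w X) + rk T)"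
  proof (rule dual_systems_block[OF dual_systems_form_rank[OF finV] dual_systems_form_rank[OF finV] _
        supp(2,3,2,3) lin_closed_supported])
    show "B f g = 0" if f: "f \<in> supported (insert w X)" and g: "g \<in> supported T" for f g
    proof (rule B_zeroI[OF TV g])
      fix t assume t: "t \<in> T"
      have "B (unit_fun t) f = 0"
        by (rule B_zeroI[OF _ f]) (use t TX wX TV in \<open>auto simp: B_units subset_eq\<close>)
      then show "B f (unit_fun t) = 0" by (simp add: B_swap)
    qed
  qed (use supp in auto)
  then have rkZ: "rk (insert w X) + rk T \<le> rk Z" using le_form_rank_iff[OF finV supp(1)] by blast
  have x2: "2 \<le> rk (insert w X)"
  proof (rule ccontr)
    assume "\<not> ?thesis"
    then have "mu (rk (insert w X)) \<le> mu 1" by (intro mu_mono) simp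
    then show False using cx by (simp add: mu_small)
  qed
  have count: "mu (r - 2) \<le> card X + card T" using count_X card_Is by linarith
  show False
  proof (cases "T = Tn")
    case True
    then obtain t u where "t \<in> T" "u \<in> T" "E t u" using Tn_edge T_nonempty by blast
    then have "2 \<le> rk T" by (rule edge_rank[OF TV])
    then have "mu (rk (insert w X)) + mu (rk T) \<le> mu (rk (insert w X) + rk T - 2) + 4"
      using x2 by (intro mu_add_le)
    moreover have "rk Z \<le> r" using rk_mono[OF Z(1) order_refl] rankV by simp
    then have "mu (rk (insert w X) + rk T - 2) \<le> mu (r - 2)" using rkZ by (intro mu_mono) simp
    moreover have "card T = card Tn" by (rule arg_cong[OF True])
    ultimately show False using count cx card_Tn by linarith
  next
    case False
    then obtain t where t: "t \<in> T" "nbh E T t = {}" by (auto simp: Tn_def)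
    have tZ: "\<not> E t y" if "y \<in> Z" for y using that t TX by (auto simp: Z_def nbh_def)
    have tV: "t \<in> V" using t TV by blast
    then obtain y where y: "y \<in> V" "E t y" using redV by (auto simp: reduced_on_def nbh_def)
    \<comment> \<open>\<open>t\<close> has no neighbour in \<open>Z\<close> but has one in
      \<open>V\<close>; these two extra ranks make up for the vertex by which \<open>T\<close>
      exceeds \<open>Tn\<close>.\<close>
    have "rk Z + 2 \<le> rk V"
    proof (rule kernel_rank[OF lin_closed_supported lin_closed_supported order_refl supp(1), of "unit_fun t" "unit_fun y"])
      show "B (unit_fun t) g = 0" if "g \<in> supported Z" for g
        by (rule B_zeroI[OF Z(1) that]) (use tZ tV Z(1) in \<open>auto simp: B_units subset_eq\<close>)
    qed (use t y Z tV in \<open>auto simp: B_units intro: unit_fun_supported\<close>)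
    then have "mu (rk (insert w X) + (rk T + 2) - 2) \<le> mu (r - 2)" using rkZ rankV by (intro mu_mono) simp
    moreover have "mu (rk (insert w X)) + mu (rk T + 2) \<le> mu (rk (insert w X) + (rk T + 2) - 2) + 4"
      using x2 by (intro mu_add_le) auto
    ultimately show False
      using count cx card_Tn card_T_Tn mu_double_le[of "rk T"] mu_ge2[of "rk T"] by linarith
  qed
qed

end

section \<open>Transfer to graphs\<close>

lemma form_rank_image_le:
  assumes fin: "finite S" and inj: "inj_on f S"
    and E: "\<And>u v. u \<in> S \<Longrightarrow> v \<in> S \<Longrightarrow> E' (f u) (f v) = E u v"
  shows "form_rank E' (f ` S) (supported (f ` S)) \<le> form_rank E S (supported S)"
proof -
  let ?k = "form_rank E' (f ` S) (supported (f ` S))"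
  define pull where "pull g = (\<lambda>x. if x \<in> S then g (f x) else 0)" for g :: "'b \<Rightarrow> real"
  have pull: "adj_form E S (pull g) (pull h) = adj_form E' (f ` S) g h" for g h
    by (simp add: adj_form_def sum.reindex[OF inj] pull_def E cong: sum.cong)
  have fin': "finite (f ` S)" using fin by simp
  from dual_systems_form_rank[OF fin' order_refl, of E']
  obtain p q where pq: "\<And>i j. i < ?k \<Longrightarrow> j < ?k \<Longrightarrow> adj_form E' (f ` S) (p i) (q j) = of_bool (i = j)"
    unfolding dual_systems_def by blast
  have "dual_systems (adj_form E S) (supported S) (supported S) ?k"
    by (rule dual_systemsI[of _ "\<lambda>i. pull (p i)" _ "\<lambda>i. pull (q i)"])
      (use pq in \<open>auto simp: pull, auto simp: pull_def supported_def\<close>)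
  then show ?thesis using le_form_rank_iff[OF fin order_refl] by blast
qed

lemma form_rank_image:
  assumes fin: "finite S" and inj: "inj_on f S"
    and E: "\<And>u v. u \<in> S \<Longrightarrow> v \<in> S \<Longrightarrow> E' (f u) (f v) = E u v"
  shows "form_rank E' (f ` S) (supported (f ` S)) = form_rank E S (supported S)"
proof (rule antisym)
  let ?g = "the_inv_into S f"
  have g: "?g (f u) = u" if "u \<in> S" for u using that inj by (rule the_inv_into_f_f[rotated])
  then have "?g ` f ` S = S" by force
  moreover have "inj_on ?g (f ` S)" using inj by (rule inj_on_the_inv_into)
  moreover have "E (?g u) (?g v) = E' u v" if "u \<in> f ` S" "v \<in> f ` S" for u v
    using that g E by auto
  ultimately show "form_rank E S (supported S) \<le> form_rank E' (f ` S) (supported (f ` S))"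
    using form_rank_image_le[of "f ` S" ?g E E'] fin by simp
qed (rule form_rank_image_le[where E = E and E' = E', OF fin inj], rule E)

lemma form_rank_cong:
  assumes "\<And>u v. u \<in> S \<Longrightarrow> v \<in> S \<Longrightarrow> E u v = E' u v"
  shows "form_rank E S U = form_rank E' S U"
proof -
  have "adj_form E S = adj_form E' S" by (intro ext adj_form_cong assms)
  then show ?thesis by (simp add: form_rank_def)
qed

lemma neighborhood_eq_nbh: "neighborhood G v = nbh (dominates G) (verts G) v"
  by (simp add: neighborhood_def nbh_def)

lemma reduced_iff_reduced_on: "reduced G \<longleftrightarrow> reduced_on (dominates G) (verts G)"
  by (auto simp: reduced_def reduced_on_def isolated_verts_def has_duplicated_verts_def
      neighborhood_eq_nbh inj_on_def)

lemma dominates_induced_subgraph: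
  assumes "induced_subgraph H G" "u \<in> verts H" "v \<in> verts H"
  shows "u \<rightarrow>\<^bsub>H\<^esub> v \<longleftrightarrow> u \<rightarrow>\<^bsub>G\<^esub> v"
  using assms unfolding induced_subgraph_def subgraph_def compatible_def arcs_ends_conv by auto

lemma dominates_induce_subgraph: "u \<rightarrow>\<^bsub>G \<restriction> S\<^esub> v \<longleftrightarrow> u \<in> S \<and> v \<in> S \<and> u \<rightarrow>\<^bsub>G\<^esub> v"
  unfolding arcs_ends_conv by auto

lemma neighborhood_induced_subgraph:
  assumes "induced_subgraph H G" "v \<in> verts H"
  shows "neighborhood H v = nbh (dominates G) (verts H) v"
  using dominates_induced_subgraph[OF assms] by (auto simp: neighborhood_def nbh_def)

lemma graph_rank_induced_subgraph:
  assumes "finite (verts G)" "induced_subgraph H G"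
  shows "graph_rank H = form_rank (dominates G) (verts G) (supported (verts H))"
proof -
  have sub: "verts H \<subseteq> verts G" using assms(2) by (simp add: induced_subgraph_def subgraph_def)
  have "graph_rank H = form_rank (dominates H) (verts H) (supported (verts H))"
    using finite_subset[OF sub assms(1)] by (rule graph_rank_eq_form_rank)
  also have "\<dots> = form_rank (dominates G) (verts H) (supported (verts H))"
    by (rule form_rank_cong) (rule dominates_induced_subgraph[OF assms(2)])
  also have "\<dots> = form_rank (dominates G) (verts G) (supported (verts H))"
    by (rule form_rank_restrict[OF assms(1) sub, symmetric])
  finally show ?thesis .
qed

lemma (in graph) dominates_sym: "u \<rightarrow> v \<Longrightarrow> v \<rightarrow> u"
  using sym_arcs by (auto simp: symmetric_def dest: symD)

lemma (in graph) dominates_irrefl: "\<not> u \<rightarrow> u"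
  using no_loops by (auto simp: arcs_ends_conv)

lemma (in graph) graph_induce_subgraph:
  assumes "S \<subseteq> verts G"
  shows "graph (G \<restriction> S)"
proof -
  have ind: "induced_subgraph (G \<restriction> S) G" using assms by (rule induced_induce)
  have "digraph (G \<restriction> S)" using ind by (rule digraphI_induced)
  moreover have "symmetric (G \<restriction> S)" using sym_arcs ind by (rule induced_graph_imp_symmetric)
  ultimately show ?thesis by (rule digraph.graphI)
qed

lemma (in graph) complete_digraph_induce_subgraph:
  assumes "S \<subseteq> verts G" "card S = k" "\<forall>u\<in>S. \<forall>v\<in>S. u \<noteq> v \<longrightarrow> u \<rightarrow> v"
  shows "K\<^bsub>k\<^esub> (G \<restriction> S)"
  unfolding complete_digraph_def
  using graph_induce_subgraph[OF assms(1)] assms dominates_irrefl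
  by (auto simp: dominates_induce_subgraph)

text \<open>The minimality hypothesis speaks of graphs on natural numbers, so induced subgraphs have
  to be copied there.\<close>

lemma nat_copy:
  fixes E :: "'a \<Rightarrow> 'a \<Rightarrow> bool"
  assumes fin: "finite S" and sym: "\<And>u v. E u v \<Longrightarrow> E v u" and irr: "\<And>u. \<not> E u u"
    and red: "reduced_on E S"
  obtains G' :: "(nat, nat \<times> nat) pre_digraph"
  where "graph G'" "reduced G'" "card (verts G') = card S"
    "graph_rank G' = form_rank E S (supported S)"
proof -
  obtain f :: "'a \<Rightarrow> nat" where inj: "inj_on f S" using finite_imp_inj_to_nat_seg[OF fin] by blast
  define G' where "G' = \<lparr>verts = f ` S, arcs = {(f u, f v) |u v. u \<in> S \<and> v \<in> S \<and> E u v},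
    tail = fst, head = snd\<rparr>"
  have "arcs G' \<subseteq> f ` S \<times> f ` S" by (auto simp: G'_def)
  then have finA: "finite (arcs G')" using fin by (auto intro: finite_subset)
  have dom: "f u \<rightarrow>\<^bsub>G'\<^esub> f v \<longleftrightarrow> E u v" if "u \<in> S" "v \<in> S" for u v
  proof
    assume "f u \<rightarrow>\<^bsub>G'\<^esub> f v"
    then obtain u' v' where "u' \<in> S" "v' \<in> S" "E u' v'" "f u = f u'" "f v = f v'"
      by (auto simp: arcs_ends_conv G'_def)
    then show "E u v" using that inj_onD[OF inj, of u u'] inj_onD[OF inj, of v v'] by simp
  next
    assume "E u v"
    then show "f u \<rightarrow>\<^bsub>G'\<^esub> f v" using that by (force simp: arcs_ends_conv G'_def)
  qed
  have "graph G'"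
  proof
    have "v \<rightarrow>\<^bsub>G'\<^esub> u" if uv: "u \<rightarrow>\<^bsub>G'\<^esub> v" for u v
    proof -
      obtain u' v' where u'v': "u' \<in> S" "v' \<in> S" "E u' v'" "u = f u'" "v = f v'"
        using uv by (auto simp: arcs_ends_conv G'_def)
      then show ?thesis using dom sym by simp
    qed
    then show "symmetric G'" unfolding symmetric_def by (intro symI)
    show "tail G' e \<noteq> head G' e" if e: "e \<in> arcs G'" for e
    proof -
      obtain u v where uv: "u \<in> S" "v \<in> S" "E u v" "e = (f u, f v)" using e by (auto simp: G'_def)
      then have "u \<noteq> v" using irr by auto
      then show ?thesis using uv inj_onD[OF inj, of u v] by (auto simp: G'_def)
    qed
  qed (use fin finA in \<open>auto simp: G'_def arc_to_ends_def\<close>)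
  moreover have "reduced G'"
  proof -
    have nb: "nbh (dominates G') (verts G') (f v) = f ` nbh E S v" if "v \<in> S" for v
      using that dom by (auto simp: nbh_def G'_def)
    have "nbh E S v \<subseteq> S" for v by (auto simp: nbh_def)
    then have "inj_on (nbh (dominates G') (verts G')) (f ` S)"
      using red nb inj by (auto simp: inj_on_def[of "nbh _ _"] inj_on_image_eq_iff reduced_on_def)
    then show ?thesis using red nb unfolding reduced_iff_reduced_on reduced_on_def by (auto simp: G'_def)
  qed
  moreover have "card (verts G') = card S" using inj by (simp add: G'_def card_image)
  moreover have "graph_rank G' = form_rank E S (supported S)"
  proof -
    have "graph_rank G' = form_rank (dominates G') (f ` S) (supported (f ` S))"
      using graph_rank_eq_form_rank[of G'] fin by (simp add: G'_def)
    also have "\<dots> = form_rank E S (supported S)" by (rule form_rank_image[where E = E and E' = "dominates G'", OF fin inj]) (rule dom)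
    finally show ?thesis .
  qed
  ultimately show thesis by (rule that)
qed

text \<open>Deleting the vertices that distinguish \<open>u\<close> from \<open>v\<close> makes
  these two duplicated; they survive because they are non-adjacent and there are no loops.\<close>

lemma (in graph) tau_le:
  assumes "u \<in> verts G" "v \<in> verts G" "u \<noteq> v" "\<not> u \<rightarrow> v"
  shows "tau G \<le> card {x \<in> verts G. (u \<rightarrow> x) \<noteq> (v \<rightarrow> x)}"
proof -
  define X where "X = {x \<in> verts G. (u \<rightarrow> x) \<noteq> (v \<rightarrow> x)}"
  have nE: "\<not> v \<rightarrow> u" using assms dominates_sym by blast
  have nb: "neighborhood (G \<restriction> (verts G - X)) u = neighborhood (G \<restriction> (verts G - X)) v"
    using assms nE dominates_irrefl by (auto simp: neighborhood_def dominates_induce_subgraph X_def)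
  have "u \<in> verts G - X" "v \<in> verts G - X" using assms nE dominates_irrefl by (auto simp: X_def)
  then have "has_duplicated_verts (G \<restriction> (verts G - X))"
    unfolding has_duplicated_verts_def by (intro bexI[of _ u] bexI[of _ v] conjI assms(3) nb) simp_all
  moreover have "X \<subseteq> verts G" by (auto simp: X_def)
  ultimately have "tau G \<le> card X" unfolding tau_def by (intro Least_le exI[of _ X]) simp
  then show ?thesis by (simp only: X_def)
qed

lemma duplication_class_of_dup:
  assumes "finite (verts H)" "v \<in> verts H" "u \<in> verts H" "u \<noteq> v" "neighborhood H u = neighborhood H v"
  shows "duplication_class H {w \<in> verts H. neighborhood H w = neighborhood H v}" (is "duplication_class H ?C")
proof -
  have "card {u, v} \<le> card ?C" using assms by (intro card_mono) auto
  then have "2 \<le> card ?C" using assms(4) by simp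
  then have "duplication_set H ?C" unfolding duplication_set_def by simp
  moreover have "D = ?C" if D: "duplication_set H D" "?C \<subseteq> D" for D
  proof -
    have "v \<in> D" using D(2) assms(2) by auto
    then have "D \<subseteq> ?C" using D(1) unfolding duplication_set_def by blast
    then show ?thesis using D(2) by blast
  qed
  ultimately show ?thesis unfolding duplication_class_def by blast
qed

lemma duplication_class_obtain_other:
  assumes "duplication_class H C" "v \<in> C"
  obtains u where "v \<in> verts H" "u \<in> verts H" "u \<noteq> v" "neighborhood H u = neighborhood H v"
proof -
  have C: "C \<subseteq> verts H" "2 \<le> card C" "\<forall>u\<in>C. \<forall>v\<in>C. neighborhood H u = neighborhood H v"
    using assms(1) unfolding duplication_class_def duplication_set_def by blast+
  have "\<not> C \<subseteq> {v}" using C(2) card_mono[of "{v}" C] by fastforce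
  then obtain u where "u \<in> C" "u \<noteq> v" by blast
  then show thesis using that C assms(2) by blast
qed

theorem theorem4p5:
  fixes G H :: "('a, 'b) pre_digraph"
    and n r \<tau> \<epsilon> :: nat
    and T :: "'a set"
  assumes "graph G" and "reduced G"
    and "n = card (verts G)" and "r = graph_rank G"
    and "r \<ge> 10" and "real n > m_bound (int r)"
    and minimal: "\<And>G' :: (nat, nat \<times> nat) pre_digraph.
          graph G' \<Longrightarrow> reduced G' \<Longrightarrow> graph_rank G' \<ge> 2 \<Longrightarrow>
          real (card (verts G')) > m_bound (int (graph_rank G')) \<Longrightarrow> n \<le> card (verts G')"
    and "\<tau> = tau G"
    and "induced_subgraph H G" and "card (verts H) = n - \<tau>"
    and "has_duplicated_verts H"
    and "graph_rank H \<ge> r - 3"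
    and "\<epsilon> = card (isolated_verts H)"
    and "T \<subseteq> \<Union> {C. duplication_class H C}"
    and "\<And>C. duplication_class H C \<Longrightarrow> \<exists>!v. v \<in> T \<inter> C"
  shows "\<epsilon> = 0 \<and>
    ((K\<^bsub>1\<^esub> (G \<restriction> T) \<and> real \<tau> \<ge> m_bound (int r - 2) + 2) \<or>
     (K\<^bsub>2\<^esub> (G \<restriction> T) \<and> real \<tau> \<ge> m_bound (int r - 2) + 1) \<or>
     (K\<^bsub>3\<^esub> (G \<restriction> T) \<and> real \<tau> = m_bound (int r - 2)))"
proof -
  interpret G: graph G by fact
  let ?V = "verts G" and ?E = "dominates G" and ?H = "verts H"
  have fin: "finite ?V" by simp
  have HV: "?H \<subseteq> ?V" using assms(9) by (simp add: induced_subgraph_def subgraph_def)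
  then have finH: "finite ?H" using fin by (rule finite_subset)
  note nbH = neighborhood_induced_subgraph[OF assms(9)]
  obtain a b where ab: "a \<in> ?H" "b \<in> ?H" "a \<noteq> b" "nbh ?E ?H a = nbh ?E ?H b"
    using assms(11) nbH by (auto simp: has_duplicated_verts_def)
  \<comment> \<open>The difference \<open>n - \<tau>\<close> is truncated; its positivity is needed
    to recover \<open>\<tau>\<close> as the number of removed vertices.\<close>
  have "card ?H > 0" using ab finH by (auto simp: card_gt_0_iff)
  then have card_X: "card (?V - ?H) = \<tau>"
    using card_Diff_subset[OF finH HV] assms(3,10) by simp
  interpret dup_subgraph ?V ?E r ?H a b
  proof
    show "finite ?V" by (rule fin)
    show "v \<rightarrow>\<^bsub>G\<^esub> u" if "u \<rightarrow>\<^bsub>G\<^esub> v" for u v using that by (rule G.dominates_sym)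
    show "\<not> u \<rightarrow>\<^bsub>G\<^esub> u" for u by (rule G.dominates_irrefl)
    show "reduced_on ?E ?V" using assms(2) by (simp add: reduced_iff_reduced_on)
    show "form_rank ?E ?V (supported ?V) = r" using assms(4) graph_rank_eq_form_rank[OF fin] by simp
    show "10 \<le> r" by fact
    show "mu r \<le> card ?V + 1" using mu_eq_m_bound[of r] assms(3,5,6) by simp
    show "card S + 2 \<le> mu (form_rank ?E ?V (supported S))"
      if S: "S \<subset> ?V" "reduced_on ?E S" "2 \<le> form_rank ?E ?V (supported S)" for S
    proof (rule ccontr)
      \<comment> \<open>A violating \<open>S\<close> would yield a counterexample of smaller order
        than \<open>G\<close>.\<close>
      assume big: "\<not> ?thesis"
      have "finite S" using S(1) fin finite_subset by blast
      then obtain G' :: "(nat, nat \<times> nat) pre_digraph" where G': "graph G'" "reduced G'"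
        "card (verts G') = card S" "graph_rank G' = form_rank ?E S (supported S)"
        using nat_copy[of S ?E] G.dominates_sym G.dominates_irrefl S(2) by blast
      have rk: "graph_rank G' = form_rank ?E ?V (supported S)"
        using G'(4) form_rank_restrict[OF fin, of S ?E] S(1) by simp
      have "m_bound (int (graph_rank G')) < real (card (verts G'))"
        using mu_eq_m_bound[of "graph_rank G'"] S(3) rk G'(3) big by simp
      then have "n \<le> card S" using minimal[OF G'(1,2)] S(3) rk G'(3) by simp
      then show False using psubset_card_mono[OF fin S(1)] assms(3) by simp
    qed
    show "?H \<subseteq> ?V" by (rule HV)
    show "card (?V - ?H) \<le> card {x \<in> ?V. (u \<rightarrow>\<^bsub>G\<^esub> x) \<noteq> (v \<rightarrow>\<^bsub>G\<^esub> x)}"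
      if "u \<in> ?V" "v \<in> ?V" "u \<noteq> v" "\<not> u \<rightarrow>\<^bsub>G\<^esub> v" for u v
      using G.tau_le[OF that] card_X assms(8) by simp
    show "r \<le> form_rank ?E ?V (supported ?H) + 3"
      using assms(12) graph_rank_induced_subgraph[OF fin assms(9)] by simp
  qed (use ab in auto)
  interpret dup_reps ?V ?E r ?H a b T
  proof
    show "T \<subseteq> Du"
    proof
      fix t assume "t \<in> T"
      then obtain C where "duplication_class H C" "t \<in> C" using assms(14) by blast
      then obtain u where "t \<in> ?H" "u \<in> ?H" "u \<noteq> t" "neighborhood H u = neighborhood H t"
        by (rule duplication_class_obtain_other)
      then show "t \<in> Du" using nbH by (auto simp: Du_def)
    qed
    fix v assume "v \<in> Du"
    then obtain u where u: "v \<in> ?H" "u \<in> ?H" "u \<noteq> v" "nbh ?E ?H u = nbh ?E ?H v" by (auto simp: Du_def)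
    then have "\<exists>!t. t \<in> T \<inter> {w \<in> ?H. neighborhood H w = neighborhood H v}"
      using nbH by (intro assms(15) duplication_class_of_dup[OF finH, of v u]) auto
    moreover have "t \<in> T \<inter> {w \<in> ?H. neighborhood H w = neighborhood H v} \<longleftrightarrow>
        t \<in> T \<and> nbh ?E ?H t = nbh ?E ?H v" for t
      using nbH u(1) \<open>T \<subseteq> Du\<close> by (auto simp: Du_def)
    ultimately show "\<exists>!t. t \<in> T \<and> nbh ?E ?H t = nbh ?E ?H v" by simp
  qed
  have "isolated_verts H = Is" using nbH by (auto simp: isolated_verts_def Is_def)
  then have eps: "\<epsilon> = 0" using Is_empty assms(13) by simp
  have X: "card X = \<tau>" using card_X by (simp add: X_def)
  have mr: "real (mu (r - 2)) = m_bound (int r - 2) + 2"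
    using mu_eq_m_bound[of "r - 2"] r10 by (simp add: of_nat_diff)
  have K: "K\<^bsub>k\<^esub> (G \<restriction> T)" if "card T = k" "\<forall>t\<in>T. \<forall>u\<in>T. t \<noteq> u \<longrightarrow> t \<rightarrow>\<^bsub>G\<^esub> u" for k
    using G.complete_digraph_induce_subgraph[OF TV that] .
  consider "card T = 1" "mu (r - 2) \<le> \<tau>"
    | "card T = 2" "\<forall>t\<in>T. \<forall>u\<in>T. t \<noteq> u \<longrightarrow> t \<rightarrow>\<^bsub>G\<^esub> u" "mu (r - 2) \<le> \<tau> + 1"
    | "card T = 3" "\<forall>t\<in>T. \<forall>u\<in>T. t \<noteq> u \<longrightarrow> t \<rightarrow>\<^bsub>G\<^esub> u" "\<tau> + 2 = mu (r - 2)"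
    using final_cases[OF Is_empty] X by auto
  then show ?thesis
  proof cases
    case 1
    then have "\<forall>t\<in>T. \<forall>u\<in>T. t \<noteq> u \<longrightarrow> t \<rightarrow>\<^bsub>G\<^esub> u" by (auto simp: card_1_singleton_iff)
    then show ?thesis using eps K[of 1] 1 mr by simp
  next
    case 2
    then show ?thesis using eps K[of 2] mr by simp
  next
    case 3
    then show ?thesis using eps K[of 3] mr by simp
  qed
qed

end
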